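(* For any 4-way deterministic aperiodic tile set $T$, the NPC square complex $W(T)$ is not virtually special, and the 2-dimensional event domain $(\widetilde W(T)_{\widetilde v},\prec_{\widetilde o^*})$ does not admit a regular nice labeling.
   Context: A Wang tile is a unit square with colored edges; a tile set $T$ is a finite set of tiles, horizontal and vertical edges using disjoint color sets. A tiling $f:\mathbb Z^2\to T$ is valid if adjacent tiles agree on common edges (no rotations); it is periodic with period $(a,b)\ne(0,0)$ if $f(x,y)=f(x+a,y+b)$ for all $(x,y)$. $T$ is aperiodic if it admits a valid tiling but no periodic valid tiling. $T$ is 4-way deterministic if no two distinct tiles agree on (top, left), nor on (top, right), nor on (bottom, left), nor on (bottom, right) colors. $\mathbf X(T)$: take the tiles as squares, horizontal edges oriented left to right, vertical edges bottom to top, identify all vertices into one and glue edges of equal color respecting orientation. $W(T)$: take the first barycentric subdivision of $\mathbf X(T)$ (edge midpoints and square centers added; half-edges keep orientation; the four new edges of each square oriented left to right and bottom to top) and attach at the midpoint of each edge of color $\alpha$ a directed path (tip) of length $r(\alpha)$, oriented away from the midpoint, for a fixed injection $r$ from colors to positive integers; call the orientation $o^*$. $\widetilde W(T)$ is the universal cover with lifted orientation $\widetilde o^*$, $\widetilde v$ a vertex lying over the vertex of $\mathbf X(T)$, and $\widetilde W(T)_{\widetilde v}$ the set of vertices reachable from $\widetilde v$ by directed paths, ordered by reachability. A finite NPC complex is virtually special if it has a finite cover which is special (hyperplanes two-sided, not self-intersecting, not directly self-osculating, and no two hyperplanes both intersecting and osculating). A nice labeling of a domain is a labeling of the directed edges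 of its Hasse diagram by a finite alphabet such that edges out of a common vertex get distinct labels and opposite edges of each square get equal labels; it is regular if there are finitely many label-preserving isomorphism types of labeled principal filters. *)

theory Defs
  imports Main
begin

text \<open>Horizontal colours have type 'h, vertical colours type 'v (so the two colour sets
are disjoint).  A tile is given by its bottom, top (horizontal) and left, right
(vertical) colours.\<close>

datatype ('h,'v) tile = Tile (tbot: 'h) (ttop: 'h) (tlft: 'v) (trgt: 'v)

definition valid_tiling :: "('h,'v) tile set \<Rightarrow> (int \<times> int \<Rightarrow> ('h,'v) tile) \<Rightarrow> bool" where
  "valid_tiling T f \<longleftrightarrow> (\<forall>p. f p \<in> T) \<and>
     (\<forall>x y. trgt (f (x,y)) = tlft (f (x+1,y)) \<and> ttop (f (x,y)) = tbot (f (x,y+1)))"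

definition periodic_tiling :: "(int \<times> int \<Rightarrow> 'a) \<Rightarrow> bool" where
  "periodic_tiling f \<longleftrightarrow> (\<exists>a b. (a,b) \<noteq> (0,0) \<and> (\<forall>x y. f (x,y) = f (x+a,y+b)))"

definition aperiodic :: "('h,'v) tile set \<Rightarrow> bool" where
  "aperiodic T \<longleftrightarrow> (\<exists>f. valid_tiling T f) \<and> \<not> (\<exists>f. valid_tiling T f \<and> periodic_tiling f)"

definition four_way_det :: "('h,'v) tile set \<Rightarrow> bool" where
  "four_way_det T \<longleftrightarrow> (\<forall>t\<in>T. \<forall>t'\<in>T.
     (ttop t = ttop t' \<and> tlft t = tlft t' \<longrightarrow> t = t') \<and>
     (ttop t = ttop t' \<and> trgt t = trgt t' \<longrightarrow> t = t') \<and>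
     (tbot t = tbot t' \<and> tlft t = tlft t' \<longrightarrow> t = t') \<and>
     (tbot t = tbot t' \<and> trgt t = trgt t' \<longrightarrow> t = t'))"

definition colors :: "('h,'v) tile set \<Rightarrow> ('h + 'v) set" where
  "colors T = Inl ` (tbot ` T \<union> ttop ` T) \<union> Inr ` (tlft ` T \<union> trgt ` T)"

text \<open>Vertices, edges (each oriented from csrc to ctgt) and squares; cbd s i (i < 4) is the
i-th side of the boundary cycle of s, as an edge together with a flag telling whether it is
traversed along (True) or against (False) its orientation.\<close>

record ('v,'e,'s) cx =
  cV :: "'v set"
  cE :: "'e set"
  cS :: "'s set"
  csrc :: "'e \<Rightarrow> 'v"
  ctgt :: "'e \<Rightarrow> 'v"
  cbd :: "'s \<Rightarrow> nat \<Rightarrow> 'e \<times> bool"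

definition side :: "('v,'e,'s,'z) cx_scheme \<Rightarrow> 's \<Rightarrow> nat \<Rightarrow> 'e \<times> bool" where
  "side X s i = cbd X s (i mod 4)"

definition sv :: "('v,'e,'s,'z) cx_scheme \<Rightarrow> 's \<Rightarrow> nat \<Rightarrow> 'v" where
  "sv X s i = (case side X s i of (e,d) \<Rightarrow> if d then csrc X e else ctgt X e)"

definition evx :: "('v,'e,'s,'z) cx_scheme \<Rightarrow> 's \<Rightarrow> nat \<Rightarrow> 'v" where
  "evx X s i = (case side X s i of (e,d) \<Rightarrow> if d then ctgt X e else csrc X e)"

definition wf_cx :: "('v,'e,'s,'z) cx_scheme \<Rightarrow> bool" where
  "wf_cx X \<longleftrightarrow> (\<forall>e\<in>cE X. csrc X e \<in> cV X \<and> ctgt X e \<in> cV X) \<and>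
     (\<forall>s\<in>cS X. \<forall>i<4. fst (side X s i) \<in> cE X \<and> evx X s i = sv X s (Suc i))"

definition is_cover ::
  "('a,'b,'c,'y) cx_scheme \<Rightarrow> ('v,'e,'s,'z) cx_scheme \<Rightarrow> ('a \<Rightarrow> 'v) \<Rightarrow> ('b \<Rightarrow> 'e) \<Rightarrow> ('c \<Rightarrow> 's) \<Rightarrow> bool" where
  "is_cover C X pv pe ps \<longleftrightarrow> wf_cx C \<and> cV C \<noteq> {} \<and> pv ` cV C = cV X \<and>
     (\<forall>e\<in>cE C. pe e \<in> cE X \<and> pv (csrc C e) = csrc X (pe e) \<and> pv (ctgt C e) = ctgt X (pe e)) \<and>
     (\<forall>s\<in>cS C. ps s \<in> cS X \<and>
        (\<forall>i<4. side X (ps s) i = (pe (fst (side C s i)), snd (side C s i)))) \<and>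
     (\<forall>x\<in>cV C.
        bij_betw pe {e\<in>cE C. csrc C e = x} {e\<in>cE X. csrc X e = pv x} \<and>
        bij_betw pe {e\<in>cE C. ctgt C e = x} {e\<in>cE X. ctgt X e = pv x} \<and>
        bij_betw (\<lambda>(s,i). (ps s, i)) {(s,i). s \<in> cS C \<and> i < 4 \<and> sv C s i = x}
                                    {(s,i). s \<in> cS X \<and> i < 4 \<and> sv X s i = pv x})"

definition finite_cover :: "('a,'b,'c,'y) cx_scheme \<Rightarrow> ('v,'e,'s,'z) cx_scheme \<Rightarrow> bool" where
  "finite_cover C X \<longleftrightarrow> finite (cV C) \<and> finite (cE C) \<and> finite (cS C) \<and>
     (\<exists>pv pe ps. is_cover C X pv pe ps)"

definition opp :: "('v,'e,'s,'z) cx_scheme \<Rightarrow> 'e \<Rightarrow> 'e \<Rightarrow> bool" where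
  "opp X e e' \<longleftrightarrow> (\<exists>s\<in>cS X. \<exists>i<4. fst (side X s i) = e \<and> fst (side X s (i+2)) = e')"

text \<open>Two edges are dual to the same hyperplane.\<close>
definition sameH :: "('v,'e,'s,'z) cx_scheme \<Rightarrow> 'e \<Rightarrow> 'e \<Rightarrow> bool" where
  "sameH X = (opp X)\<^sup>*\<^sup>*"

definition corner :: "('v,'e,'s,'z) cx_scheme \<Rightarrow> 'e \<Rightarrow> 'e \<Rightarrow> 'v \<Rightarrow> bool" where
  "corner X e1 e2 v \<longleftrightarrow> (\<exists>s\<in>cS X. \<exists>i<4.
      {fst (side X s i), fst (side X s (Suc i))} = {e1, e2} \<and> evx X s i = v)"

definition osculate :: "('v,'e,'s,'z) cx_scheme \<Rightarrow> 'e \<Rightarrow> 'e \<Rightarrow> 'v \<Rightarrow> bool" where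
  "osculate X e1 e2 v \<longleftrightarrow> e1 \<in> cE X \<and> e2 \<in> cE X \<and> e1 \<noteq> e2 \<and>
     (csrc X e1 = v \<or> ctgt X e1 = v) \<and> (csrc X e2 = v \<or> ctgt X e2 = v) \<and>
     \<not> corner X e1 e2 v"

text \<open>sigma e says whether the transverse orientation of the hyperplane dual to e agrees with
the orientation of e; two-sidedness = opposite sides of every square are parallel.\<close>
definition two_sided_orient :: "('v,'e,'s,'z) cx_scheme \<Rightarrow> ('e \<Rightarrow> bool) \<Rightarrow> bool" where
  "two_sided_orient X \<sigma> \<longleftrightarrow> (\<forall>s\<in>cS X. \<forall>i<4.
     (snd (side X s i) = \<sigma> (fst (side X s i))) \<noteq>
     (snd (side X s (i+2)) = \<sigma> (fst (side X s (i+2)))))"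

definition hinit :: "('v,'e,'s,'z) cx_scheme \<Rightarrow> ('e \<Rightarrow> bool) \<Rightarrow> 'e \<Rightarrow> 'v" where
  "hinit X \<sigma> e = (if \<sigma> e then csrc X e else ctgt X e)"

definition hterm :: "('v,'e,'s,'z) cx_scheme \<Rightarrow> ('e \<Rightarrow> bool) \<Rightarrow> 'e \<Rightarrow> 'v" where
  "hterm X \<sigma> e = (if \<sigma> e then ctgt X e else csrc X e)"

definition self_intersecting :: "('v,'e,'s,'z) cx_scheme \<Rightarrow> bool" where
  "self_intersecting X \<longleftrightarrow> (\<exists>s\<in>cS X. \<exists>i<4. sameH X (fst (side X s i)) (fst (side X s (Suc i))))"

definition direct_self_osc :: "('v,'e,'s,'z) cx_scheme \<Rightarrow> ('e \<Rightarrow> bool) \<Rightarrow> bool" where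
  "direct_self_osc X \<sigma> \<longleftrightarrow> (\<exists>e1 e2 v. sameH X e1 e2 \<and> osculate X e1 e2 v \<and>
     ((hinit X \<sigma> e1 = v \<and> hinit X \<sigma> e2 = v) \<or> (hterm X \<sigma> e1 = v \<and> hterm X \<sigma> e2 = v)))"

definition interosculating :: "('v,'e,'s,'z) cx_scheme \<Rightarrow> bool" where
  "interosculating X \<longleftrightarrow> (\<exists>e1 e2 f1 f2 v. \<not> sameH X e1 e2 \<and> sameH X e1 f1 \<and> sameH X e2 f2 \<and>
     (\<exists>s\<in>cS X. \<exists>i<4. {fst (side X s i), fst (side X s (Suc i))} = {e1, e2}) \<and>
     osculate X f1 f2 v)"

definition special :: "('v,'e,'s,'z) cx_scheme \<Rightarrow> bool" where
  "special X \<longleftrightarrow> (\<exists>\<sigma>. two_sided_orient X \<sigma> \<and> \<not> direct_self_osc X \<sigma>) \<and>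
     \<not> self_intersecting X \<and> \<not> interosculating X"

text \<open>Every finite cover is isomorphic to one whose cells are numbered by naturals.\<close>
definition virtually_special :: "('v,'e,'s,'z) cx_scheme \<Rightarrow> bool" where
  "virtually_special X \<longleftrightarrow> (\<exists>C :: (nat,nat,nat) cx. finite_cover C X \<and> special C)"

fun is_path :: "('v,'e,'s,'z) cx_scheme \<Rightarrow> 'v \<Rightarrow> ('e \<times> bool) list \<Rightarrow> bool" where
  "is_path X v [] = True"
| "is_path X v ((e,d) # p) = (e \<in> cE X \<and> (if d then csrc X e else ctgt X e) = v \<and>
      is_path X (if d then ctgt X e else csrc X e) p)"

definition inv_path :: "('e \<times> bool) list \<Rightarrow> ('e \<times> bool) list" where
  "inv_path p = rev (map (\<lambda>(e,d). (e, \<not> d)) p)"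

definition relators :: "('v,'e,'s,'z) cx_scheme \<Rightarrow> 's \<Rightarrow> ('e \<times> bool) list set" where
  "relators X s = (let w = map (side X s) [0..<4] in
      {rotate k w | k. k < 4} \<union> {rotate k (inv_path w) | k. k < 4})"

definition hstep :: "('v,'e,'s,'z) cx_scheme \<Rightarrow> 'v \<Rightarrow> ('e \<times> bool) list \<Rightarrow> ('e \<times> bool) list \<Rightarrow> bool" where
  "hstep X v p q \<longleftrightarrow> is_path X v p \<and> is_path X v q \<and>
     ((\<exists>a b e d. p = a @ [(e,d),(e,\<not> d)] @ b \<and> q = a @ b) \<or>
      (\<exists>a b c s. s \<in> cS X \<and> c \<in> relators X s \<and> p = a @ c @ b \<and> q = a @ b))"

definition homot :: "('v,'e,'s,'z) cx_scheme \<Rightarrow> 'v \<Rightarrow> ('e \<times> bool) list \<Rightarrow> ('e \<times> bool) list \<Rightarrow> bool" where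
  "homot X v = (\<lambda>p q. hstep X v p q \<or> hstep X v q p)\<^sup>*\<^sup>*"

text \<open>Vertices of the universal cover are homotopy classes of edge paths from the base
vertex v; those reachable from the base lift by directed paths (w.r.t. the lifted
orientation) are the classes of paths all of whose edges are traversed forwards.\<close>
definition dom_elems :: "('v,'e,'s,'z) cx_scheme \<Rightarrow> 'v \<Rightarrow> ('e \<times> bool) list set set" where
  "dom_elems X v = {{q. homot X v p q} | p. is_path X v p \<and> list_all snd p}"

definition dle :: "('v,'e,'s,'z) cx_scheme \<Rightarrow> 'v \<Rightarrow> ('e \<times> bool) list set \<Rightarrow> ('e \<times> bool) list set \<Rightarrow> bool" where
  "dle X v x y \<longleftrightarrow> (\<exists>p\<in>x. \<exists>r. list_all snd r \<and> p @ r \<in> y)"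

definition covers :: "'a set \<Rightarrow> ('a \<Rightarrow> 'a \<Rightarrow> bool) \<Rightarrow> 'a \<Rightarrow> 'a \<Rightarrow> bool" where
  "covers D le x y \<longleftrightarrow> x \<in> D \<and> y \<in> D \<and> le x y \<and> x \<noteq> y \<and>
     \<not> (\<exists>z\<in>D. le x z \<and> le z y \<and> z \<noteq> x \<and> z \<noteq> y)"

definition nice_labeling :: "'a set \<Rightarrow> ('a \<Rightarrow> 'a \<Rightarrow> bool) \<Rightarrow> ('a \<Rightarrow> 'a \<Rightarrow> 'l) \<Rightarrow> bool" where
  "nice_labeling D le lab \<longleftrightarrow>
     finite {lab x y | x y. covers D le x y} \<and>
     (\<forall>x y z. covers D le x y \<and> covers D le x z \<and> y \<noteq> z \<longrightarrow> lab x y \<noteq> lab x z) \<and>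
     (\<forall>a b c d. covers D le a b \<and> covers D le a c \<and> covers D le b d \<and> covers D le c d \<and> b \<noteq> c
        \<longrightarrow> lab a b = lab c d \<and> lab a c = lab b d)"

definition up :: "'a set \<Rightarrow> ('a \<Rightarrow> 'a \<Rightarrow> bool) \<Rightarrow> 'a \<Rightarrow> 'a set" where
  "up D le x = {y \<in> D. le x y}"

definition filter_iso :: "'a set \<Rightarrow> ('a \<Rightarrow> 'a \<Rightarrow> bool) \<Rightarrow> ('a \<Rightarrow> 'a \<Rightarrow> 'l) \<Rightarrow> 'a \<Rightarrow> 'a \<Rightarrow> bool" where
  "filter_iso D le lab x y \<longleftrightarrow> (\<exists>f. bij_betw f (up D le x) (up D le y) \<and>
     (\<forall>a\<in>up D le x. \<forall>b\<in>up D le x. le a b \<longleftrightarrow> le (f a) (f b)) \<and>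
     (\<forall>a\<in>up D le x. \<forall>b\<in>up D le x. covers D le a b \<longrightarrow> lab a b = lab (f a) (f b)))"

definition regular_labeling :: "'a set \<Rightarrow> ('a \<Rightarrow> 'a \<Rightarrow> bool) \<Rightarrow> ('a \<Rightarrow> 'a \<Rightarrow> 'l) \<Rightarrow> bool" where
  "regular_labeling D le lab \<longleftrightarrow>
     (\<exists>F. finite F \<and> F \<subseteq> D \<and> (\<forall>x\<in>D. \<exists>y\<in>F. filter_iso D le lab x y))"

definition regular_nice_labeling :: "'a set \<Rightarrow> ('a \<Rightarrow> 'a \<Rightarrow> bool) \<Rightarrow> ('a \<Rightarrow> 'a \<Rightarrow> 'l) \<Rightarrow> bool" where
  "regular_nice_labeling D le lab \<longleftrightarrow> nice_labeling D le lab \<and> regular_labeling D le lab"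

datatype ('h,'v) wvert = Base | Mid "'h + 'v" | Ctr "('h,'v) tile" | TipV "'h + 'v" nat

text \<open>HA c / HB c: first / second half of the edge of colour c;
InL, OutR, InB, OutT: the four new edges inside a tile (left-mid to centre, centre to
right-mid, bottom-mid to centre, centre to top-mid); TipE c k: k-th edge of the tip at c.\<close>
datatype ('h,'v) wedge = HA "'h + 'v" | HB "'h + 'v" | InL "('h,'v) tile" | OutR "('h,'v) tile"
  | InB "('h,'v) tile" | OutT "('h,'v) tile" | TipE "'h + 'v" nat

fun wsrc :: "('h,'v) wedge \<Rightarrow> ('h,'v) wvert" where
  "wsrc (HA c) = Base"
| "wsrc (HB c) = Mid c"
| "wsrc (InL t) = Mid (Inr (tlft t))"
| "wsrc (OutR t) = Ctr t"
| "wsrc (InB t) = Mid (Inl (tbot t))"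
| "wsrc (OutT t) = Ctr t"
| "wsrc (TipE c k) = (if k = 1 then Mid c else TipV c (k - 1))"

fun wtgt :: "('h,'v) wedge \<Rightarrow> ('h,'v) wvert" where
  "wtgt (HA c) = Mid c"
| "wtgt (HB c) = Base"
| "wtgt (InL t) = Ctr t"
| "wtgt (OutR t) = Mid (Inr (trgt t))"
| "wtgt (InB t) = Ctr t"
| "wtgt (OutT t) = Mid (Inl (ttop t))"
| "wtgt (TipE c k) = TipV c k"

text \<open>Quadrants 0,1,2,3 = bottom-left, bottom-right, top-left, top-right of a tile.\<close>
definition quad :: "('h,'v) tile \<Rightarrow> nat \<Rightarrow> (('h,'v) wedge \<times> bool) list" where
  "quad t q = (let b = Inl (tbot t); u = Inl (ttop t); l = Inr (tlft t); r = Inr (trgt t) in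
     if q = 0 then [(HA b, True), (InB t, True), (InL t, False), (HA l, False)]
     else if q = 1 then [(HB b, True), (HA r, True), (OutR t, False), (InB t, False)]
     else if q = 2 then [(InL t, True), (OutT t, True), (HA u, False), (HB l, False)]
     else [(OutR t, True), (HB r, True), (HB u, False), (OutT t, False)])"

definition WT :: "('h,'v) tile set \<Rightarrow> ('h + 'v \<Rightarrow> nat) \<Rightarrow>
    (('h,'v) wvert, ('h,'v) wedge, ('h,'v) tile \<times> nat) cx" where
  "WT T r = \<lparr> cV = {Base} \<union> Mid ` colors T \<union> Ctr ` T \<union>
                   {TipV c k | c k. c \<in> colors T \<and> 1 \<le> k \<and> k \<le> r c},
             cE = HA ` colors T \<union> HB ` colors T \<union> InL ` T \<union> OutR ` T \<union> InB ` T \<union> OutT ` T \<union>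
                   {TipE c k | c k. c \<in> colors T \<and> 1 \<le> k \<and> k \<le> r c},
             cS = T \<times> {0..<4},
             csrc = wsrc, ctgt = wtgt,
             cbd = (\<lambda>(t,q) i. quad t q ! (i mod 4)) \<rparr>"

end

theory Submission
  imports Defs
begin

text \<open>
  Both claims have the same reason. Start from a valid tiling and develop its first quadrant
  along positively oriented edges, either into a finite special cover or into the event domain.
  Label an edge of the cover by its hyperplane, an edge of the domain by its nice label. Since
  opposite edges of squares have equal labels, all columns of the quadrant carry the same vertical
  label sequence. By finiteness two corners on the bottom row are equivalent (the same vertex of
  the cover, or isomorphic labeled filters); as edges out of a vertex have distinct
  labels, the equivalence propagates up the two columns, and equivalent edge midpoints have the
  same color (in the domain the color is read off the length of the attached tip, the only finite
  filter directly above the midpoint). Thus the strip between the two columns has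
  equal left and right sides, and a repeated row in it closes up to a torus.
\<close>

section \<open>From a strip with equal sides to a periodic tiling\<close>

lemma mod_succ_cases:
  fixes x w :: int
  assumes "0 < w"
  shows "(x + 1) mod w = (if x mod w + 1 = w then 0 else x mod w + 1)"
proof -
  have "(x + 1) mod w = (x mod w + 1) mod w"
    by (simp add: mod_add_left_eq)
  moreover have "0 \<le> x mod w" "x mod w < w"
    using assms by auto
  ultimately show ?thesis
    by (auto intro: mod_pos_pos_trivial)
qed

lemma pigeonhole_nat:
  assumes "finite A" and "\<And>n :: nat. g n \<in> A"
  obtains i j where "i < j" and "g i = g j"
proof -
  have "\<not> inj g"
    using assms by (meson finite_subset image_subsetI infinite_UNIV_nat finite_imageD)
  then obtain i j where "i \<noteq> j" "g i = g j"
    by (auto simp: inj_def)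
  then show thesis
    using that[of i j] that[of j i] by (cases "i < j") auto
qed

text \<open>Column \<open>i' - 1\<close> has on its right the colors that column \<open>i\<close>
  has on its left, so the strip can be repeated horizontally. Only finitely many rows of width
  \<open>i' - i\<close> exist; two equal ones bound a rectangle that also repeats
  vertically.\<close>

lemma periodic_from_strip:
  assumes fin: "finite T" and f: "valid_tiling T f" and lt: "i < i'"
    and sides: "\<And>j :: nat. tlft (f (int i, int j)) = tlft (f (int i', int j))"
  shows "\<not> aperiodic T"
proof -
  define row where "row j = map (\<lambda>k. f (int (i + k), int j)) [0..<i' - i]" for j :: nat
  have fT: "f p \<in> T" for p
    using f unfolding valid_tiling_def by blast
  have "row j \<in> {xs. set xs \<subseteq> T \<and> length xs = i' - i}" for j
    using fT by (auto simp: row_def)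
  then obtain j j' where j: "j < j'" "row j = row j'"
    using pigeonhole_nat[of "{xs. set xs \<subseteq> T \<and> length xs = i' - i}" row]
      finite_lists_length_eq[OF fin] by metis
  have rows: "f (int i + k, int j) = f (int i + k, int j')" if "0 \<le> k" "k < int i' - int i" for k
  proof -
    have "nat k < i' - i"
      using that lt by linarith
    then have "row m ! nat k = f (int i + k, int m)" for m
      using that by (simp add: row_def)
    then show ?thesis
      using j(2) by metis
  qed
  define w h where "w = int i' - int i" and "h = int j' - int j"
  have wh: "0 < w" "0 < h"
    using lt j(1) by (auto simp: w_def h_def)
  \<comment> \<open>The \<open>w\<close> by \<open>h\<close> rectangle with lower left tile at
    \<open>(i, j)\<close>, repeated over the whole plane.\<close>
  define g where "g = (\<lambda>(x, y). f (int i + x mod w, int j + y mod h))"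
  have R: "trgt (f (x, y)) = tlft (f (x + 1, y))" and U: "ttop (f (x, y)) = tbot (f (x, y + 1))"
    for x y using f by (auto simp: valid_tiling_def)
  have "trgt (g (x, y)) = tlft (g (x + 1, y))" for x y
  proof (cases "x mod w + 1 = w")
    case True
    \<comment> \<open>At the seam \<open>sides\<close> applies, which speaks of natural heights
      only; hence the conversion of \<open>y mod h\<close> by \<open>nat\<close>.\<close>
    have nn: "0 \<le> y mod h"
      using wh by simp
    have "int i + x mod w + 1 = int i'"
      using True by (simp add: w_def)
    then have "trgt (g (x, y)) = tlft (f (int i', int (j + nat (y mod h))))"
      using R nn by (simp add: g_def)
    also have "\<dots> = tlft (f (int i, int (j + nat (y mod h))))"
      by (rule sides[symmetric])
    finally show ?thesis
      using nn True wh by (simp add: g_def mod_succ_cases)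
  next
    case False
    then show ?thesis
      using R wh by (simp add: g_def mod_succ_cases add.assoc)
  qed
  moreover have "ttop (g (x, y)) = tbot (g (x, y + 1))" for x y
  proof (cases "y mod h + 1 = h")
    case True
    have "int j + y mod h + 1 = int j'"
      using True by (simp add: h_def)
    then have "ttop (g (x, y)) = tbot (f (int i + x mod w, int j'))"
      using U by (simp add: g_def)
    also have "\<dots> = tbot (f (int i + x mod w, int j))"
      using rows[of "x mod w"] wh by (simp add: w_def)
    finally show ?thesis
      using True wh by (simp add: g_def mod_succ_cases)
  next
    case False
    then show ?thesis
      using U wh by (simp add: g_def mod_succ_cases add.assoc)
  qed
  ultimately have "valid_tiling T g"
    using fT by (simp add: valid_tiling_def g_def)
  moreover have "periodic_tiling g"
    unfolding periodic_tiling_def using wh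
    by (intro exI[of _ w] exI[of _ 0]) (simp add: g_def)
  ultimately show ?thesis
    by (auto simp: aperiodic_def)
qed

section \<open>Directed squares\<close>

text \<open>The boundary word is \<open>a b\<close> followed by the inverse of \<open>d c\<close>,
  so both two-edge paths run from the least to the greatest corner. \<open>quad\<close> lists each
  quadrant from its least corner on, hence every square of \<open>WT T r\<close> has this
  form.\<close>

definition dsq :: "('v,'e,'s,'z) cx_scheme \<Rightarrow> 'e \<Rightarrow> 'e \<Rightarrow> 'e \<Rightarrow> 'e \<Rightarrow> bool" where
  "dsq X a b c d \<longleftrightarrow> (\<exists>s\<in>cS X. side X s 0 = (a, True) \<and> side X s 1 = (b, True) \<and>
     side X s 2 = (c, False) \<and> side X s 3 = (d, False))"

lemma dsqD:
  assumes "wf_cx X" and "dsq X a b c d"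
  shows "a \<in> cE X" "b \<in> cE X" "c \<in> cE X" "d \<in> cE X"
    and "csrc X d = csrc X a" "csrc X b = ctgt X a" "csrc X c = ctgt X d" "ctgt X c = ctgt X b"
proof -
  obtain s where s: "s \<in> cS X" "side X s 0 = (a, True)" "side X s 1 = (b, True)"
      "side X s 2 = (c, False)" "side X s 3 = (d, False)"
    using assms(2) by (auto simp: dsq_def)
  have *: "fst (side X s i) \<in> cE X \<and> evx X s i = sv X s (Suc i)" if "i < 4" for i
    using assms(1) s(1) that by (auto simp: wf_cx_def)
  have "side X s 4 = side X s 0"
    by (simp add: side_def)
  then show "a \<in> cE X" "b \<in> cE X" "c \<in> cE X" "d \<in> cE X"
    "csrc X d = csrc X a" "csrc X b = ctgt X a" "csrc X c = ctgt X d" "ctgt X c = ctgt X b"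
    using *[of 0] *[of 1] *[of 2] *[of 3] s
    by (auto simp: evx_def sv_def numeral_eq_Suc)
qed

section \<open>The square complex of a tile set\<close>

lemma WT_sel [simp]: "csrc (WT T r) = wsrc" "ctgt (WT T r) = wtgt"
  by (simp_all add: WT_def)

lemma WT_edges:
  "HA c \<in> cE (WT T r) \<longleftrightarrow> c \<in> colors T"
  "HB c \<in> cE (WT T r) \<longleftrightarrow> c \<in> colors T"
  "InL t \<in> cE (WT T r) \<longleftrightarrow> t \<in> T"
  "OutR t \<in> cE (WT T r) \<longleftrightarrow> t \<in> T"
  "InB t \<in> cE (WT T r) \<longleftrightarrow> t \<in> T"
  "OutT t \<in> cE (WT T r) \<longleftrightarrow> t \<in> T"
  "TipE c k \<in> cE (WT T r) \<longleftrightarrow> c \<in> colors T \<and> 1 \<le> k \<and> k \<le> r c"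
  by (auto simp: WT_def)

lemma colors_tile:
  assumes "t \<in> T"
  shows "Inl (tbot t) \<in> colors T" "Inl (ttop t) \<in> colors T"
    "Inr (tlft t) \<in> colors T" "Inr (trgt t) \<in> colors T"
  using assms by (auto simp: colors_def)

lemma WT_side: "side (WT T r) (t, q) i = quad t q ! (i mod 4)"
  by (simp add: side_def WT_def)

lemma WT_cS: "cS (WT T r) = T \<times> {0..<4}"
  by (simp add: WT_def)

lemma less4: "(i :: nat) < 4 \<longleftrightarrow> i = 0 \<or> i = 1 \<or> i = 2 \<or> i = 3"
  by auto

lemma wf_WT: "wf_cx (WT T r)"
proof -
  have "wsrc e \<in> cV (WT T r) \<and> wtgt e \<in> cV (WT T r)" if "e \<in> cE (WT T r)" for e
    using that by (auto simp: WT_def colors_def)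
  moreover have "fst (side (WT T r) s i) \<in> cE (WT T r) \<and> evx (WT T r) s i = sv (WT T r) s (Suc i)"
    if si: "s \<in> cS (WT T r)" "i < 4" for s i
  proof -
    obtain t q where s: "s = (t, q)" "t \<in> T" "q < 4"
      using si(1) unfolding WT_cS by (cases s) simp
    show ?thesis
      using s(3) si(2) colors_tile[OF s(2)] unfolding less4 s(1)
      by (elim disjE) (simp_all add: WT_side quad_def Let_def evx_def sv_def WT_edges s(2))
  qed
  ultimately show ?thesis
    by (simp add: wf_cx_def)
qed

text \<open>Read off from the four boundary words. This fact makes transverse orientations
  consistent along the hyperplanes of a cover, and it makes \<open>height\<close> invariant under
  homotopy.\<close>

lemma WT_parallel:
  assumes "s \<in> cS (WT T r)" and "i < 4"
  shows "snd (side (WT T r) s (i + 2)) \<longleftrightarrow> \<not> snd (side (WT T r) s i)"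
proof -
  obtain t q where s: "s = (t, q)" "t \<in> T" "q < 4"
    using assms(1) unfolding WT_cS by (cases s) simp
  show ?thesis
    using s(3) assms(2) unfolding less4 s(1)
    by (elim disjE) (simp_all add: WT_side quad_def Let_def)
qed

lemma WT_dsq:
  assumes "t \<in> T"
  shows "dsq (WT T r) (HA (Inl (tbot t))) (InB t) (InL t) (HA (Inr (tlft t)))"
    and "dsq (WT T r) (HB (Inl (tbot t))) (HA (Inr (trgt t))) (OutR t) (InB t)"
    and "dsq (WT T r) (InL t) (OutT t) (HA (Inl (ttop t))) (HB (Inr (tlft t)))"
    and "dsq (WT T r) (OutR t) (HB (Inr (trgt t))) (HB (Inl (ttop t))) (OutT t)"
proof -
  have *: "dsq (WT T r) a b c d" if "quad t q = [(a, True), (b, True), (c, False), (d, False)]"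
    "q < 4" for a b c d q
    unfolding dsq_def using that assms
    by (intro bexI[of _ "(t, q)"]) (simp_all add: WT_side WT_cS)
  show "dsq (WT T r) (HA (Inl (tbot t))) (InB t) (InL t) (HA (Inr (tlft t)))"
    by (rule *[of 0]) (simp_all add: quad_def Let_def)
  show "dsq (WT T r) (HB (Inl (tbot t))) (HA (Inr (trgt t))) (OutR t) (InB t)"
    by (rule *[of 1]) (simp_all add: quad_def Let_def)
  show "dsq (WT T r) (InL t) (OutT t) (HA (Inl (ttop t))) (HB (Inr (tlft t)))"
    by (rule *[of 2]) (simp_all add: quad_def Let_def)
  show "dsq (WT T r) (OutR t) (HB (Inr (trgt t))) (HB (Inl (ttop t))) (OutT t)"
    by (rule *[of 3]) (simp_all add: quad_def Let_def)
qed

section \<open>Developing a quadrant\<close>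

text \<open>The common core of both claims. A point \<open>x\<close> lies over the vertex
  \<open>en x\<close>, \<open>step\<close> follows a directed edge, and \<open>R\<close> compares
  points. In a cover these are projection, lifting and equality; in the domain they are the end
  vertex, extension by an edge and isomorphism of labeled filters. \<open>square\<close> carries
  labels to the opposite side, \<open>det\<close> propagates \<open>R\<close> along equal labels,
  and \<open>color\<close> recognizes midpoints.\<close>

locale development =
  fixes T :: "('h,'v) tile set" and r :: "'h + 'v \<Rightarrow> nat"
    and S :: "'x set" and en :: "'x \<Rightarrow> ('h,'v) wvert"
    and step :: "'x \<Rightarrow> ('h,'v) wedge \<Rightarrow> 'x" and lab :: "'x \<Rightarrow> ('h,'v) wedge \<Rightarrow> 'l"
    and R :: "'x \<Rightarrow> 'x \<Rightarrow> bool"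
  assumes start: "\<exists>x\<in>S. en x = Base"
    and step: "\<And>x e. \<lbrakk>x \<in> S; e \<in> cE (WT T r); wsrc e = en x\<rbrakk> \<Longrightarrow> step x e \<in> S \<and> en (step x e) = wtgt e"
    and square: "\<And>x a b c d. \<lbrakk>x \<in> S; dsq (WT T r) a b c d; wsrc a = en x\<rbrakk> \<Longrightarrow>
      step (step x a) b = step (step x d) c \<and> lab x d = lab (step x a) b"
    and det: "\<And>x x' e e'. \<lbrakk>x \<in> S; x' \<in> S; R x x'; e \<in> cE (WT T r); e' \<in> cE (WT T r);
      wsrc e = en x; wsrc e' = en x'; lab x e = lab x' e'\<rbrakk> \<Longrightarrow> R (step x e) (step x' e')"
    and color: "\<And>x x' c c'. \<lbrakk>x \<in> S; x' \<in> S; en x = Mid c; en x' = Mid c'; R x x';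
      c \<in> colors T; c' \<in> colors T\<rbrakk> \<Longrightarrow> c = c'"
    and recurrent: "\<And>Q :: nat \<Rightarrow> 'x. (\<And>i. Q i \<in> S) \<Longrightarrow> \<exists>i j. i < j \<and> R (Q i) (Q j)"
begin

definition estep :: "'x \<Rightarrow> 'h + 'v \<Rightarrow> 'x" where
  "estep x c = step (step x (HA c)) (HB c)"

lemma half_step:
  assumes "x \<in> S" "en x = Base" "c \<in> colors T"
  shows "step x (HA c) \<in> S" "en (step x (HA c)) = Mid c"
  using step[of x "HA c"] assms by (auto simp: WT_edges)

lemma estep:
  assumes "x \<in> S" "en x = Base" "c \<in> colors T"
  shows "estep x c \<in> S" "en (estep x c) = Base"
  using step[of "step x (HA c)" "HB c"] half_step[OF assms] assms
  by (auto simp: WT_edges estep_def)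

text \<open>The four quadrants are glued around the center of \<open>t\<close>. The label of the
  lower half of the left side reaches the right side through \<open>InB t\<close>, that of the upper
  half through \<open>OutT t\<close>.\<close>

lemma tile_step:
  assumes x: "x \<in> S" "en x = Base" and t: "t \<in> T"
  defines "b \<equiv> Inl (tbot t)" and "u \<equiv> Inl (ttop t)" and "l \<equiv> Inr (tlft t)" and "g \<equiv> Inr (trgt t)"
  shows "estep (estep x b) g = estep (estep x l) u"
    and "lab x (HA l) = lab (estep x b) (HA g)"
    and "lab (step x (HA l)) (HB l) = lab (step (estep x b) (HA g)) (HB g)"
proof -
  have col: "b \<in> colors T" "u \<in> colors T" "l \<in> colors T" "g \<in> colors T"
    using colors_tile[OF t] by (simp_all add: b_def u_def l_def g_def)
  note q = WT_dsq[OF t, of r, folded b_def u_def l_def g_def]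
  define m k where "m = step x (HA b)" and "k = step x (HA l)"
  \<comment> \<open>The point over the center of the tile, reached here through the bottom midpoint;
    the first quadrant shows that the left midpoint leads to it as well.\<close>
  define z where "z = step m (InB t)"
  have m: "m \<in> S" "en m = Mid b" and k: "k \<in> S" "en k = Mid l"
    unfolding m_def k_def using half_step x col by auto
  have z: "z \<in> S" "en z = Ctr t"
    unfolding z_def using step[of m "InB t"] m t by (auto simp: WT_edges b_def)
  have 0: "z = step k (InL t)" "lab x (HA l) = lab m (InB t)"
    using square[OF x(1) q(1)] x(2) by (auto simp: z_def m_def k_def)
  have 1: "step (estep x b) (HA g) = step z (OutR t)" "lab m (InB t) = lab (estep x b) (HA g)"
    using square[OF m(1) q(2)] m(2) by (auto simp: z_def m_def estep_def)
  have 2: "step z (OutT t) = step (estep x l) (HA u)" "lab k (HB l) = lab z (OutT t)"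
    using square[OF k(1) q(3)] k(2) by (auto simp: 0(1) k_def l_def estep_def)
  have 3: "step (step z (OutR t)) (HB g) = step (step z (OutT t)) (HB u)"
    "lab z (OutT t) = lab (step z (OutR t)) (HB g)"
    using square[OF z(1) q(4)] z(2) by auto
  show "estep (estep x b) g = estep (estep x l) u"
    unfolding estep_def[of "estep x b"] estep_def[of "estep x l"] using 1 2 3 by simp
  show "lab x (HA l) = lab (estep x b) (HA g)"
    using 0 1 by simp
  show "lab (step x (HA l)) (HB l) = lab (step (estep x b) (HA g)) (HB g)"
    using 1 2 3 by (simp add: k_def)
qed

lemma not_aperiodic:
  assumes "finite T"
  shows "\<not> aperiodic T"
proof (cases "\<exists>f. valid_tiling T f")
  case False
  then show ?thesis
    by (simp add: aperiodic_def)
next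
  case True
  then obtain f where f: "valid_tiling T f"
    by blast
  define t where "t i j = f (int i, int j)" for i j :: nat
  have tT: "t i j \<in> T" for i j
    using f by (simp add: valid_tiling_def t_def)
  define h v where "h i j = (Inl (tbot (t i j)) :: 'h + 'v)"
    and "v i j = (Inr (tlft (t i j)) :: 'h + 'v)" for i j
  have adj: "Inl (ttop (t i j)) = h i (Suc j)" "Inr (trgt (t i j)) = v (Suc i) j" for i j
    using f by (auto simp: valid_tiling_def t_def h_def v_def add.commute)
  have col: "h i j \<in> colors T" "v i j \<in> colors T" for i j
    using colors_tile[OF tT] by (auto simp: h_def v_def)
  obtain x0 where x0: "x0 \<in> S" "en x0 = Base"
    using start by blast
  \<comment> \<open>\<open>B\<close> walks along the bottom row of the quadrant, and
    \<open>Q i\<close> climbs from \<open>B i\<close> along the left sides of column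
    \<open>i\<close>.\<close>
  define B where "B = rec_nat x0 (\<lambda>i x. estep x (h i 0))"
  define Q where "Q i = rec_nat (B i) (\<lambda>j x. estep x (v i j))" for i
  have Q0: "Q (Suc i) 0 = estep (Q i 0) (h i 0)" and QS: "Q i (Suc j) = estep (Q i j) (v i j)" for i j
    by (simp_all add: Q_def B_def)
  have Q: "Q i j \<in> S \<and> en (Q i j) = Base" for i j
  proof (induction j)
    case 0
    show ?case
    proof (induction i)
      case 0
      then show ?case using x0 by (simp add: Q_def B_def)
    next
      case (Suc i)
      then show ?case using estep col by (simp add: Q0)
    qed
  next
    case (Suc j)
    then show ?case using estep col by (simp add: QS)
  qed
  have tile: "estep (estep (Q i j) (h i j)) (v (Suc i) j) = estep (estep (Q i j) (v i j)) (h i (Suc j))"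
    "lab (Q i j) (HA (v i j)) = lab (estep (Q i j) (h i j)) (HA (v (Suc i) j))"
    "lab (step (Q i j) (HA (v i j))) (HB (v i j)) =
      lab (step (estep (Q i j) (h i j)) (HA (v (Suc i) j))) (HB (v (Suc i) j))" for i j
    using tile_step[of "Q i j" "t i j"] Q tT adj by (simp_all add: h_def[symmetric] v_def[symmetric])
  \<comment> \<open>The grid is built column by column; tile by tile, going up, it is seen to follow
    the horizontal edges too.\<close>
  have hor: "Q (Suc i) j = estep (Q i j) (h i j)" for i j
    by (induction j) (simp_all add: Q0 QS tile(1))
  \<comment> \<open>Crossing one tile after another, the vertical labels are carried back to column
    0.\<close>
  have labA: "lab (Q i j) (HA (v i j)) = lab (Q 0 j) (HA (v 0 j))" for i j
    by (induction i) (simp_all add: hor tile(2)[symmetric])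
  have labB: "lab (step (Q i j) (HA (v i j))) (HB (v i j)) =
      lab (step (Q 0 j) (HA (v 0 j))) (HB (v 0 j))" for i j
    by (induction i) (simp_all add: hor tile(3)[symmetric])
  obtain i i' where i: "i < i'" "R (Q i 0) (Q i' 0)"
    using recurrent[of "\<lambda>i. Q i 0"] Q by blast
  \<comment> \<open>The colors \<open>v i j\<close> and \<open>v i' j\<close> are not yet known to
    agree. Equal labels are enough for \<open>det\<close> to reach related midpoints, where
    \<open>color\<close> identifies the two colors; a second use of \<open>det\<close> completes the
    edge.\<close>
  have up: "v i j = v i' j \<and> R (Q i (Suc j)) (Q i' (Suc j))" if "R (Q i j) (Q i' j)" for j
  proof -
    have RM: "R (step (Q i j) (HA (v i j))) (step (Q i' j) (HA (v i' j)))"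
      using det[OF _ _ that] Q labA[of i j] labA[of i' j] col by (simp add: WT_edges)
    have M: "step (Q k j) (HA (v k j)) \<in> S" "en (step (Q k j) (HA (v k j))) = Mid (v k j)" for k
      using half_step Q col by auto
    have "R (Q i (Suc j)) (Q i' (Suc j))"
      using det[OF M(1) M(1) RM, of "HB (v i j)" "HB (v i' j)"] labB[of i j] labB[of i' j] col M(2)
      by (simp add: WT_edges QS estep_def)
    moreover have "v i j = v i' j"
      using color[OF M(1) M(1) M(2) M(2) RM] col by simp
    ultimately show ?thesis by simp
  qed
  have "R (Q i j) (Q i' j)" for j
    by (induction j) (use i up in auto)
  then have "v i j = v i' j" for j
    using up by blast
  then have "tlft (f (int i, int j)) = tlft (f (int i', int j))" for j
    by (simp add: v_def t_def)
  then show ?thesis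
    using periodic_from_strip[OF assms f i(1)] by blast
qed

end

section \<open>Finite special covers\<close>

lemma opp_sym:
  assumes "opp X e e'"
  shows "opp X e' e"
proof -
  obtain s i where s: "s \<in> cS X" "i < 4" "fst (side X s i) = e" "fst (side X s (i + 2)) = e'"
    using assms by (auto simp: opp_def)
  have "side X s ((i + 2) mod 4) = side X s (i + 2)"
    by (simp add: side_def)
  moreover have "((i + 2) mod 4 + 2) mod 4 = i mod 4"
    using s(2) unfolding less4 by auto
  then have "side X s ((i + 2) mod 4 + 2) = side X s i"
    unfolding side_def by simp
  ultimately show ?thesis
    unfolding opp_def using s by (intro bexI[of _ s] exI[of _ "(i + 2) mod 4"]) auto
qed

lemma sameH_sym: "sameH X e e' \<Longrightarrow> sameH X e' e"
  unfolding sameH_def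
  by (metis opp_sym sympD sympI symp_rtranclp)

text \<open>Lets the set of all parallel edges serve as a label: equal labels mean equal
  hyperplanes.\<close>

lemma sameH_equiv: "{f. sameH X e f} = {f. sameH X e' f} \<longleftrightarrow> sameH X e e'"
proof -
  have "sameH X e f \<longleftrightarrow> sameH X e' f" if "sameH X e e'" for f
    using that sameH_sym[OF that] unfolding sameH_def by (meson rtranclp_trans)
  moreover have "sameH X e' e'"
    by (simp add: sameH_def)
  ultimately show ?thesis
    by blast
qed

locale special_cover =
  fixes T :: "('h,'v) tile set" and r :: "'h + 'v \<Rightarrow> nat"
    and C :: "('a,'b,'c) cx" and pv pe ps
  assumes cover: "is_cover C (WT T r) pv pe ps" and fin: "finite (cV C)" and special: "special C"
begin

lemma cover_edge:
  assumes "e \<in> cE C"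
  shows "pe e \<in> cE (WT T r)" "pv (csrc C e) = wsrc (pe e)" "pv (ctgt C e) = wtgt (pe e)"
  using assms cover by (auto simp: is_cover_def)

lemma wf: "wf_cx C"
  using cover by (simp add: is_cover_def)

lemma lift_unique:
  assumes "x \<in> cV C" "e \<in> cE (WT T r)" "wsrc e = pv x"
  shows "\<exists>!e'. e' \<in> cE C \<and> csrc C e' = x \<and> pe e' = e"
proof -
  have "bij_betw pe {e \<in> cE C. csrc C e = x} {e \<in> cE (WT T r). wsrc e = pv x}"
    using assms(1) cover by (auto simp: is_cover_def)
  then have img: "pe ` {e \<in> cE C. csrc C e = x} = {e \<in> cE (WT T r). wsrc e = pv x}"
    and inj: "inj_on pe {e \<in> cE C. csrc C e = x}"
    by (simp_all add: bij_betw_def)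
  have "e \<in> pe ` {e \<in> cE C. csrc C e = x}"
    using assms img by simp
  then obtain e' where "e' \<in> cE C" "csrc C e' = x" "pe e' = e"
    by blast
  then show ?thesis
    using inj by (intro ex1I[of _ e']) (auto dest: inj_onD)
qed

definition lift where "lift x e = (THE e'. e' \<in> cE C \<and> csrc C e' = x \<and> pe e' = e)"

lemma lift:
  assumes "x \<in> cV C" "e \<in> cE (WT T r)" "wsrc e = pv x"
  shows "lift x e \<in> cE C" "csrc C (lift x e) = x" "pe (lift x e) = e"
  using theI'[OF lift_unique[OF assms]] by (auto simp: lift_def)

lemma lift_eqI:
  assumes "e' \<in> cE C"
  shows "lift (csrc C e') (pe e') = e'"
proof -
  have "csrc C e' \<in> cV C"
    using wf assms by (simp add: wf_cx_def)
  then show ?thesis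
    using the1_equality[OF lift_unique[of "csrc C e'" "pe e'"], of e'] cover_edge[OF assms] assms
    by (simp add: lift_def)
qed

lemma side_cover:
  assumes "s \<in> cS C"
  shows "ps s \<in> cS (WT T r)"
    and "side (WT T r) (ps s) i = (pe (fst (side C s i)), snd (side C s i))"
proof -
  have "\<forall>i<4. side (WT T r) (ps s) i = (pe (fst (side C s i)), snd (side C s i))"
    using assms cover by (auto simp: is_cover_def)
  then have "side (WT T r) (ps s) (i mod 4) = (pe (fst (side C s (i mod 4))), snd (side C s (i mod 4)))"
    by simp
  then show "side (WT T r) (ps s) i = (pe (fst (side C s i)), snd (side C s i))"
    by (simp add: side_def)
  show "ps s \<in> cS (WT T r)"
    using assms cover by (auto simp: is_cover_def)
qed

text \<open>The bijection on square corners in \<open>is_cover\<close> gives a square of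
  \<open>C\<close> whose initial corner is \<open>x\<close>. Its sides project to \<open>a\<close>,
  \<open>b\<close>, \<open>c\<close>, \<open>d\<close>, so unique lifting identifies them with the
  lifts.\<close>

lemma lift_dsq:
  assumes x: "x \<in> cV C" and sq: "dsq (WT T r) a b c d" and ax: "wsrc a = pv x"
  shows "dsq C (lift x a) (lift (ctgt C (lift x a)) b) (lift (ctgt C (lift x d)) c) (lift x d)"
proof -
  obtain s where s: "s \<in> cS (WT T r)" "side (WT T r) s 0 = (a, True)" "side (WT T r) s 1 = (b, True)"
      "side (WT T r) s 2 = (c, False)" "side (WT T r) s 3 = (d, False)"
    using sq by (auto simp: dsq_def)
  have "bij_betw (\<lambda>(s,i). (ps s, i)) {(s,i). s \<in> cS C \<and> i < 4 \<and> sv C s i = x}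
      {(s,i). s \<in> cS (WT T r) \<and> i < 4 \<and> sv (WT T r) s i = pv x}"
    using x cover by (auto simp: is_cover_def)
  moreover have "(s, 0) \<in> {(s,i). s \<in> cS (WT T r) \<and> i < 4 \<and> sv (WT T r) s i = pv x}"
    using s ax by (simp add: sv_def)
  ultimately have "(s, 0) \<in> (\<lambda>(s,i). (ps s, i)) ` {(s,i). s \<in> cS C \<and> i < 4 \<and> sv C s i = x}"
    by (simp add: bij_betw_def)
  then obtain s' where s': "s' \<in> cS C" "ps s' = s" "sv C s' 0 = x"
    by auto
  define a' b' c' d' where "a' = fst (side C s' 0)" and "b' = fst (side C s' 1)"
    and "c' = fst (side C s' 2)" and "d' = fst (side C s' 3)"
  then have a': "pe a' = a" "pe b' = b" "pe c' = c" "pe d' = d"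
    "side C s' 0 = (a', True)" "side C s' 1 = (b', True)" "side C s' 2 = (c', False)"
    "side C s' 3 = (d', False)"
    using side_cover(2)[OF s'(1), of 0] side_cover(2)[OF s'(1), of 1]
      side_cover(2)[OF s'(1), of 2] side_cover(2)[OF s'(1), of 3] s s'(2)
    by (auto simp: prod_eq_iff)
  have sq': "dsq C a' b' c' d'"
    unfolding dsq_def using s'(1) a' by blast
  note D = dsqD[OF wf sq']
  have "csrc C a' = x"
    using s'(3) a' by (simp add: sv_def)
  then show ?thesis
    using sq' D lift_eqI[OF D(1)] lift_eqI[OF D(2)] lift_eqI[OF D(3)] lift_eqI[OF D(4)] a'(1-4)
    by simp
qed

text \<open>Two distinct edges of one hyperplane with a common source either span a corner of a
  square, which is a self-intersection, or osculate; the osculation is direct because the given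
  orientation is parallel across squares.\<close>

lemma same_hyperplane_same_source:
  assumes H: "sameH C e e'" and e: "e \<in> cE C" "e' \<in> cE C" "csrc C e = csrc C e'"
  shows "e = e'"
proof (rule ccontr)
  assume ne: "e \<noteq> e'"
  obtain \<sigma> where \<sigma>: "two_sided_orient C \<sigma>" "\<not> direct_self_osc C \<sigma>"
    and si: "\<not> self_intersecting C"
    using special by (auto simp: special_def)
  \<comment> \<open>Opposite sides are traversed in opposite senses, so two-sidedness forces
    \<open>\<sigma>\<close> to agree on them and hence on the whole hyperplane.\<close>
  have "\<sigma> f = \<sigma> f'" if o: "opp C f f'" for f f'
  proof -
    obtain s i where s: "s \<in> cS C" "i < 4" "fst (side C s i) = f" "fst (side C s (i + 2)) = f'"
      using o by (auto simp: opp_def)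
    then have "snd (side C s (i + 2)) \<longleftrightarrow> \<not> snd (side C s i)"
      using WT_parallel[OF side_cover(1)[OF s(1)] s(2)] by (simp add: side_cover(2)[OF s(1)])
    moreover have "(snd (side C s i) = \<sigma> f) \<noteq> (snd (side C s (i + 2)) = \<sigma> f')"
      using \<sigma>(1) s by (auto simp: two_sided_orient_def)
    ultimately show ?thesis
      by auto
  qed
  note \<sigma>opp = this
  have "(opp C)\<^sup>*\<^sup>* e e'"
    using H by (simp add: sameH_def)
  then have \<sigma>eq: "\<sigma> e = \<sigma> e'"
    by (induction rule: rtranclp_induct) (auto dest: \<sigma>opp)
  have "\<not> corner C e e' (csrc C e)"
  proof
    assume "corner C e e' (csrc C e)"
    then obtain s i where s: "s \<in> cS C" "i < 4"
      "{fst (side C s i), fst (side C s (Suc i))} = {e, e'}"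
      by (auto simp: corner_def)
    then have "sameH C (fst (side C s i)) (fst (side C s (Suc i)))"
      using H sameH_sym[OF H] by (auto simp: doubleton_eq_iff)
    then show False
      using si s by (auto simp: self_intersecting_def)
  qed
  then have "osculate C e e' (csrc C e)"
    using e ne by (auto simp: osculate_def)
  \<comment> \<open>Both edges leave the same vertex and have the same \<open>\<sigma>\<close>, so
    this vertex is the initial end of both or the terminal end of both.\<close>
  then have "direct_self_osc C \<sigma>"
    unfolding direct_self_osc_def using H \<sigma>eq e
    by (intro exI[of _ e] exI[of _ e'] exI[of _ "csrc C e"]) (auto simp: hinit_def hterm_def)
  then show False
    using \<sigma>(2) by simp
qed

text \<open>Labels are hyperplanes and \<open>R\<close> is equality. \<open>det\<close> is the
  absence of direct self-osculation and self-intersection, and recurrence is the finiteness of the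
  vertex set.\<close>

sublocale development T r "cV C" pv "\<lambda>x e. ctgt C (lift x e)" "\<lambda>x e. {f. sameH C (lift x e) f}" "(=)"
proof
  show "\<exists>x\<in>cV C. pv x = Base"
  proof -
    have "Base \<in> cV (WT T r)"
      by (simp add: WT_def)
    then have "Base \<in> pv ` cV C"
      using cover by (simp add: is_cover_def)
    then show ?thesis
      by force
  qed
next
  fix x e
  assume *: "x \<in> cV C" "e \<in> cE (WT T r)" "wsrc e = pv x"
  show "ctgt C (lift x e) \<in> cV C \<and> pv (ctgt C (lift x e)) = wtgt e"
    using lift[OF *] cover_edge(3) wf by (auto simp: wf_cx_def)
next
  fix x a b c d
  assume *: "x \<in> cV C" "dsq (WT T r) a b c d" "wsrc a = pv x"
  let ?a = "lift x a" and ?b = "lift (ctgt C (lift x a)) b"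
    and ?c = "lift (ctgt C (lift x d)) c" and ?d = "lift x d"
  have sq: "dsq C ?a ?b ?c ?d"
    by (rule lift_dsq[OF *])
  then have "opp C ?b ?d"
    by (auto simp: dsq_def opp_def numeral_eq_Suc intro!: bexI exI[of _ 1])
  then have "sameH C ?d ?b"
    using opp_sym[of C ?b ?d] by (auto simp: sameH_def)
  then show "ctgt C ?b = ctgt C ?c \<and> {f. sameH C ?d f} = {f. sameH C ?b f}"
    using dsqD(8)[OF wf sq] by (simp add: sameH_equiv)
next
  fix x x' e e'
  assume *: "x \<in> cV C" "x' \<in> cV C" "x = x'" "e \<in> cE (WT T r)" "e' \<in> cE (WT T r)"
    "wsrc e = pv x" "wsrc e' = pv x'" "{f. sameH C (lift x e) f} = {f. sameH C (lift x' e') f}"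
  then have "lift x e = lift x' e'"
    using lift by (intro same_hyperplane_same_source) (auto simp: sameH_equiv)
  then show "ctgt C (lift x e) = ctgt C (lift x' e')"
    by simp
next
  fix Q :: "nat \<Rightarrow> 'a"
  assume "\<And>i. Q i \<in> cV C"
  then show "\<exists>i j. i < j \<and> Q i = Q j"
    using pigeonhole_nat[OF fin, of Q] by blast
qed auto

end

section \<open>The event domain\<close>

definition pend :: "('v,'e,'s,'z) cx_scheme \<Rightarrow> 'v \<Rightarrow> ('e \<times> bool) list \<Rightarrow> 'v" where
  "pend X = foldl (\<lambda>_ (e, d). if d then ctgt X e else csrc X e)"

text \<open>Once shown invariant under homotopy, this is a rank function on the domain: the length
  of any directed representative.\<close>

definition height :: "('e \<times> bool) list \<Rightarrow> int" where
  "height p = (\<Sum>(e, d)\<leftarrow>p. if d then 1 else - 1)"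

definition cls :: "('v,'e,'s,'z) cx_scheme \<Rightarrow> 'v \<Rightarrow> ('e \<times> bool) list \<Rightarrow> ('e \<times> bool) list set" where
  "cls X v p = {q. homot X v p q}"

lemma pend_simps [simp]:
  "pend X v [] = v"
  "pend X v ((e, d) # p) = pend X (if d then ctgt X e else csrc X e) p"
  "pend X v (p @ q) = pend X (pend X v p) q"
  by (simp_all add: pend_def)

lemma height_simps [simp]:
  "height [] = 0"
  "height ((e, d) # p) = (if d then 1 else - 1) + height p"
  "height (p @ q) = height p + height q"
  by (simp_all add: height_def)

lemma is_path_append [simp]: "is_path X v (p @ q) \<longleftrightarrow> is_path X v p \<and> is_path X (pend X v p) q"
  by (induction p arbitrary: v) auto

lemma height_positive: "list_all snd p \<Longrightarrow> height p = int (length p)"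
  by (induction p) auto

lemma homot_refl [simp]: "homot X v p p"
  by (simp add: homot_def)

lemma homot_sym: "homot X v p q \<Longrightarrow> homot X v q p"
  unfolding homot_def by (metis (no_types, lifting) sympD sympI symp_rtranclp)

lemma homot_trans: "homot X v p q \<Longrightarrow> homot X v q s \<Longrightarrow> homot X v p s"
  unfolding homot_def by (rule rtranclp_trans)

lemma hstep_homot: "hstep X v p q \<Longrightarrow> homot X v p q"
  unfolding homot_def by (rule r_into_rtranclp) simp

lemma cls_eq_iff: "cls X v p = cls X v q \<longleftrightarrow> homot X v p q"
proof
  assume "cls X v p = cls X v q"
  then have "q \<in> cls X v p"
    by (simp add: cls_def)
  then show "homot X v p q"
    by (simp add: cls_def)
next
  assume "homot X v p q"
  then show "cls X v p = cls X v q"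
    unfolding cls_def using homot_trans[of X v p q] homot_trans[of X v q p] homot_sym[of X v p q]
    by auto
qed

lemma cls_self: "p \<in> cls X v p"
  by (simp add: cls_def)

lemma homot_invariant:
  assumes "homot X v p q" and "\<And>p q. hstep X v p q \<Longrightarrow> \<phi> p = \<phi> q"
  shows "\<phi> p = \<phi> q"
  using assms(1) unfolding homot_def
  by (induction rule: rtranclp_induct) (auto dest: assms(2))

lemma homot_is_path: "homot X v p q \<Longrightarrow> is_path X v p \<longleftrightarrow> is_path X v q"
  by (rule homot_invariant) (auto simp: hstep_def)

section \<open>Homotopy invariants in a directed square complex\<close>

locale directed_cx =
  fixes X :: "('v,'e,'s,'z) cx_scheme" and v :: 'v
  assumes wf: "wf_cx X"
    and parallel: "\<And>s i. s \<in> cS X \<Longrightarrow> i < 4 \<Longrightarrow> snd (side X s (i + 2)) \<longleftrightarrow> \<not> snd (side X s i)"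
    and no_multi_edges: "\<And>e e'. \<lbrakk>e \<in> cE X; e' \<in> cE X; csrc X e = csrc X e'; ctgt X e = ctgt X e'\<rbrakk> \<Longrightarrow> e = e'"
begin

text \<open>The boundary of a square closes up, and its opposite sides contribute opposite signs to
  the height.\<close>

lemma relator:
  assumes s: "s \<in> cS X" and c: "c \<in> relators X s" and p: "is_path X u c"
  shows "pend X u c = u" and "height c = 0"
proof -
  obtain e0 d0 e1 d1 e2 d2 e3 d3 where
    sd: "side X s 0 = (e0, d0)" "side X s 1 = (e1, d1)" "side X s 2 = (e2, d2)" "side X s 3 = (e3, d3)"
    by (metis surj_pair)
  have par: "d2 \<longleftrightarrow> \<not> d0" "d3 \<longleftrightarrow> \<not> d1"
    using parallel[OF s, of 0] parallel[OF s, of 1] sd by (auto simp: numeral_eq_Suc)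
  have *: "evx X s i = sv X s (Suc i)" if "i < 4" for i
    using wf s that by (auto simp: wf_cx_def)
  have "side X s 4 = side X s 0"
    by (simp add: side_def)
  then have cyc: "evx X s 0 = sv X s 1" "evx X s 1 = sv X s 2" "evx X s 2 = sv X s 3" "evx X s 3 = sv X s 0"
    using *[of 0] *[of 1] *[of 2] *[of 3] by (simp_all add: numeral_eq_Suc sv_def)
  define w where "w = [(e0, d0), (e1, d1), (e2, d2), (e3, d3)]"
  have "map (side X s) [0..<4] = w"
    using sd by (simp add: w_def upt_rec numeral_eq_Suc)
  then obtain k where k: "k < 4" "c = rotate k w \<or> c = rotate k (inv_path w)"
    using c by (auto simp: relators_def Let_def)
  \<comment> \<open>Four rotations of the word and of its inverse leave eight explicit words to
    evaluate.\<close>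
  then have "c \<in> {w, rotate1 w, rotate1 (rotate1 w), rotate1 (rotate1 (rotate1 w)),
      inv_path w, rotate1 (inv_path w), rotate1 (rotate1 (inv_path w)),
      rotate1 (rotate1 (rotate1 (inv_path w)))}"
    unfolding less4 by (auto simp: rotate_def numeral_eq_Suc)
  then have "pend X u c = u \<and> height c = 0"
    using p cyc sd par unfolding w_def inv_path_def sv_def evx_def
    by (auto split: if_splits)
  then show "pend X u c = u" "height c = 0"
    by auto
qed

lemma hstep_invariants:
  assumes "hstep X v p q"
  shows "pend X v p = pend X v q" "height p = height q"
proof -
  have paths: "is_path X v p" "is_path X v q"
    using assms by (auto simp: hstep_def)
  from assms consider
    (cancel) a b e d where "p = a @ [(e, d), (e, \<not> d)] @ b" "q = a @ b"
    | (square) a b c s where "s \<in> cS X" "c \<in> relators X s" "p = a @ c @ b" "q = a @ b"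
    unfolding hstep_def by blast
  then have "pend X v p = pend X v q \<and> height p = height q"
  proof cases
    case cancel
    then show ?thesis using paths by auto
  next
    case square
    then show ?thesis using paths relator[OF square(1,2)] by auto
  qed
  then show "pend X v p = pend X v q" "height p = height q"
    by auto
qed

lemma homot_pend: "homot X v p q \<Longrightarrow> pend X v p = pend X v q"
  by (rule homot_invariant) (auto dest: hstep_invariants)

lemma homot_height: "homot X v p q \<Longrightarrow> height p = height q"
  by (rule homot_invariant) (auto dest: hstep_invariants)

text \<open>An elementary step stays elementary after a common path is appended; invariance of the
  end vertex keeps the appended part attachable along the whole chain of steps.\<close>

lemma homot_append:
  assumes "homot X v p q" and "is_path X (pend X v p) s"
  shows "homot X v (p @ s) (q @ s)"
proof -
  have ext: "hstep X v (a @ s) (b @ s)" if ab: "hstep X v a b" and a: "is_path X (pend X v a) s" for a b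
  proof -
    have "is_path X v a" "is_path X v b" "pend X v a = pend X v b"
      using ab hstep_invariants(1) by (auto simp: hstep_def)
    moreover from ab consider
      (cancel) a' b' e d where "a = a' @ [(e, d), (e, \<not> d)] @ b'" "b = a' @ b'"
      | (square) a' b' c t where "t \<in> cS X" "c \<in> relators X t" "a = a' @ c @ b'" "b = a' @ b'"
      unfolding hstep_def by blast
    then have "(\<exists>a' b' e d. a @ s = a' @ [(e, d), (e, \<not> d)] @ b' \<and> b @ s = a' @ b') \<or>
      (\<exists>a' b' c t. t \<in> cS X \<and> c \<in> relators X t \<and> a @ s = a' @ c @ b' \<and> b @ s = a' @ b')"
    proof cases
      case cancel
      then have "a @ s = a' @ [(e, d), (e, \<not> d)] @ (b' @ s)" "b @ s = a' @ (b' @ s)"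
        by auto
      then show ?thesis by blast
    next
      case square
      then have "a @ s = a' @ c @ (b' @ s)" "b @ s = a' @ (b' @ s)"
        by auto
      then show ?thesis using square(1,2) by blast
    qed
    ultimately show ?thesis
      using a by (simp add: hstep_def)
  qed
  show ?thesis
    using assms(1) unfolding homot_def[of X v]
  proof (induction rule: rtranclp_induct)
    case base
    then show ?case by simp
  next
    case (step b c)
    have "homot X v p b"
      using step(1) by (simp add: homot_def)
    from homot_pend[OF this] have b: "is_path X (pend X v b) s"
      using assms(2) by simp
    from step(2) have "homot X v (b @ s) (c @ s)"
    proof
      assume "hstep X v b c"
      then show ?thesis
        using ext b by (intro hstep_homot) simp
    next
      assume bc: "hstep X v c b"
      then have "is_path X (pend X v c) s"
        using b hstep_invariants(1) by simp
      then show ?thesis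
        using ext[OF bc] by (intro homot_sym[OF hstep_homot])
    qed
    then show ?case
      using homot_trans[of X v "p @ s"] step(3) by (simp add: homot_def)
  qed
qed

section \<open>The order of the event domain\<close>

abbreviation "D \<equiv> dom_elems X v"
abbreviation "le \<equiv> dle X v"
abbreviation "cl \<equiv> cls X v"

definition dpath :: "('e \<times> bool) list \<Rightarrow> bool" where
  "dpath p \<longleftrightarrow> is_path X v p \<and> list_all snd p"

lemma D_iff: "x \<in> D \<longleftrightarrow> (\<exists>p. dpath p \<and> x = cl p)"
  by (auto simp: dom_elems_def dpath_def cls_def)

lemma cl_in_D: "dpath p \<Longrightarrow> cl p \<in> D"
  by (auto simp: D_iff)

text \<open>\<open>dle\<close> lets the representative of the lower class vary. Since homotopies
  extend to the right, a fixed representative \<open>p\<close> can be used throughout.\<close>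

lemma le_iff:
  assumes "is_path X v q"
  shows "le (cl p) (cl q) \<longleftrightarrow> (\<exists>s. list_all snd s \<and> is_path X (pend X v p) s \<and> cl q = cl (p @ s))"
    (is "?L \<longleftrightarrow> ?R")
proof
  assume ?L
  then obtain p' s where s: "homot X v p p'" "list_all snd s" "homot X v q (p' @ s)"
    by (auto simp: dle_def cls_def)
  then have "is_path X v (p' @ s)"
    using assms homot_is_path[OF s(3)] by simp
  then have *: "is_path X (pend X v p') s"
    by simp
  then have "is_path X (pend X v p) s"
    using homot_pend[OF s(1)] by simp
  moreover have "homot X v q (p @ s)"
    by (rule homot_trans[OF s(3) homot_append[OF homot_sym[OF s(1)] *]])
  ultimately show ?R
    using s(2) by (auto simp: cls_eq_iff)
next
  assume ?R
  then obtain s where "list_all snd s" "cl q = cl (p @ s)"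
    by blast
  then show ?L
    unfolding dle_def
    by (intro bexI[of _ p] exI[of _ s] conjI cls_self) (simp_all add: cls_self)
qed

lemma le_refl:
  assumes "x \<in> D"
  shows "le x x"
proof -
  obtain p where "dpath p" "x = cl p"
    using assms by (auto simp: D_iff)
  moreover have "list_all snd []" "is_path X (pend X v p) []" "cl p = cl (p @ [])"
    by simp_all
  ultimately show ?thesis
    using le_iff[of p p] unfolding dpath_def by blast
qed

lemma up_eq:
  assumes "dpath p"
  shows "up D le (cl p) = {cl (p @ s) | s. list_all snd s \<and> is_path X (pend X v p) s}" (is "_ = ?U")
proof -
  have "cl (p @ s) \<in> up D le (cl p)" if s: "list_all snd s" "is_path X (pend X v p) s" for s
  proof -
    have ps: "dpath (p @ s)"
      using assms s by (simp add: dpath_def)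
    then have "le (cl p) (cl (p @ s))"
      using le_iff[of "p @ s" p] s unfolding dpath_def by blast
    then show ?thesis
      using cl_in_D[OF ps] by (simp add: up_def)
  qed
  moreover have "y \<in> ?U" if y: "y \<in> up D le (cl p)" for y
  proof -
    obtain q where q: "dpath q" "y = cl q"
      using y by (auto simp: up_def D_iff)
    then have "le (cl p) (cl q)"
      using y by (simp add: up_def)
    then show ?thesis
      using le_iff[of q p] q unfolding dpath_def by blast
  qed
  ultimately show ?thesis
    by blast
qed

lemma le_trans:
  assumes "x \<in> D" "y \<in> D" "z \<in> D" "le x y" "le y z"
  shows "le x z"
proof -
  obtain p q o' where p: "dpath p" "x = cl p" and q: "dpath q" "y = cl q" and o: "dpath o'" "z = cl o'"
    using assms by (auto simp: D_iff)
  obtain s where s: "list_all snd s" "is_path X (pend X v p) s" "homot X v q (p @ s)"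
    using assms(4) le_iff q p by (auto simp: dpath_def cls_eq_iff)
  obtain s' where s': "list_all snd s'" "is_path X (pend X v q) s'" "homot X v o' (q @ s')"
    using assms(5) le_iff q o by (auto simp: dpath_def cls_eq_iff)
  have "homot X v o' (p @ (s @ s'))"
    using homot_append[OF s(3) s'(2)] s'(3) homot_trans by (metis append_assoc)
  moreover have "is_path X (pend X v p) (s @ s')"
    using s s' homot_pend[OF s(3)] by simp
  ultimately show ?thesis
    using le_iff[of o' p] s(1) s'(1) o p by (auto simp: dpath_def cls_eq_iff intro!: exI[of _ "s @ s'"])
qed

text \<open>Each connecting path raises the height by its length, so paths in both directions must
  be empty.\<close>

lemma le_antisym:
  assumes "x \<in> D" "y \<in> D" "le x y" "le y x"
  shows "x = y"
proof -
  obtain p q where p: "dpath p" "x = cl p" and q: "dpath q" "y = cl q"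
    using assms by (auto simp: D_iff)
  obtain s where s: "list_all snd s" "homot X v q (p @ s)"
    using assms(3) le_iff q p by (auto simp: dpath_def cls_eq_iff)
  obtain s' where s': "list_all snd s'" "homot X v p (q @ s')"
    using assms(4) le_iff q p by (auto simp: dpath_def cls_eq_iff)
  have "height q = height p + int (length s)" "height p = height q + int (length s')"
    using homot_height[OF s(2)] homot_height[OF s'(2)] s(1) s'(1) by (auto simp: height_positive)
  then have "length s = 0"
    by linarith
  then show ?thesis
    using s(2) p q by (simp add: cls_eq_iff homot_sym)
qed

definition out :: "('e \<times> bool) list \<Rightarrow> 'e \<Rightarrow> bool" where
  "out p e \<longleftrightarrow> e \<in> cE X \<and> csrc X e = pend X v p"

lemma out_dpath: "dpath p \<Longrightarrow> out p e \<Longrightarrow> dpath (p @ [(e, True)])"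
  by (simp add: out_def dpath_def)

text \<open>The Hasse diagram is the directed graph itself: a single edge raises the height by one,
  which leaves no room in between.\<close>

lemma covers_iff:
  assumes p: "dpath p"
  shows "covers D le (cl p) y \<longleftrightarrow> (\<exists>e. out p e \<and> y = cl (p @ [(e, True)]))"
proof
  assume c: "covers D le (cl p) y"
  then have y: "y \<in> up D le (cl p)" "y \<noteq> cl p"
    by (auto simp: covers_def up_def)
  then obtain s where s: "list_all snd s" "is_path X (pend X v p) s" "y = cl (p @ s)"
    unfolding up_eq[OF p] by blast
  then obtain e s' where s': "s = (e, True) # s'"
    using y(2) by (cases s) auto
  then have e: "out p e"
    using s(2) by (simp add: out_def)
  \<comment> \<open>The first edge of the path already leads to an element between
    \<open>cl p\<close> and \<open>y\<close>, which can only be \<open>y\<close>.\<close>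
  let ?z = "cl (p @ [(e, True)])"
  have "?z \<in> up D le (cl p)"
    using e by (auto simp: up_eq[OF p] out_def intro!: exI[of _ "[(e, True)]"])
  moreover have "y \<in> up D le ?z"
    using s s' by (auto simp: up_eq[OF out_dpath[OF p e]] intro!: exI[of _ s'])
  moreover have "?z \<noteq> cl p"
    using homot_height[of "p @ [(e, True)]" p] by (auto simp: cls_eq_iff)
  ultimately have "y = ?z"
    using c by (auto simp: covers_def up_def)
  then show "\<exists>e. out p e \<and> y = cl (p @ [(e, True)])"
    using e by blast
next
  assume "\<exists>e. out p e \<and> y = cl (p @ [(e, True)])"
  then obtain e where e: "out p e" and y: "y = cl (p @ [(e, True)])"
    by blast
  note pe = out_dpath[OF p e]
  have "y \<in> up D le (cl p)"
    using e y by (auto simp: up_eq[OF p] out_def intro!: exI[of _ "[(e, True)]"])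
  moreover have "cl p \<noteq> y"
    using homot_height[of p "p @ [(e, True)]"] y by (auto simp: cls_eq_iff)
  moreover have False if z: "z \<in> D" "le (cl p) z" "le z y" "z \<noteq> cl p" "z \<noteq> y" for z
  proof -
    have "z \<in> up D le (cl p)"
      using z by (simp add: up_def)
    then obtain s where s: "list_all snd s" "is_path X (pend X v p) s" "z = cl (p @ s)"
      using up_eq[OF p] by auto
    have ps: "dpath (p @ s)"
      using p s by (simp add: dpath_def)
    have "y \<in> up D le (cl (p @ s))"
      using z s y cl_in_D[OF pe] by (simp add: up_def)
    then obtain s' where s': "list_all snd s'" "y = cl ((p @ s) @ s')"
      using up_eq[OF ps] by auto
    have "homot X v (p @ [(e, True)]) ((p @ s) @ s')"
      using s' y by (simp add: cls_eq_iff)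
    from homot_height[OF this] have "length s + length s' = 1"
      using s s' by (simp add: height_positive)
    then have "length s = 0 \<or> length s' = 0"
      by linarith
    then have "s = [] \<or> s' = []"
      by simp
    then show False
      using s s' z by auto
  qed
  ultimately show "covers D le (cl p) y"
    using cl_in_D[OF p] by (auto simp: covers_def up_def)
qed

text \<open>Homotopic paths have the same end vertex, and an edge is determined by its two
  ends.\<close>

lemma cl_edge_inj:
  assumes "dpath p" "out p e" "out p e'" "cl (p @ [(e, True)]) = cl (p @ [(e', True)])"
  shows "e = e'"
  using assms homot_pend[of "p @ [(e, True)]" "p @ [(e', True)]"] no_multi_edges
  by (auto simp: cls_eq_iff out_def)

lemma homot_square:
  assumes p: "dpath p" and sq: "dsq X a b c d" and a: "out p a"
  shows "homot X v (p @ [(a, True), (b, True)]) (p @ [(d, True), (c, True)])"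
proof -
  note S = dsqD[OF wf sq]
  obtain s where s: "s \<in> cS X" "side X s 0 = (a, True)" "side X s 1 = (b, True)"
      "side X s 2 = (c, False)" "side X s 3 = (d, False)"
    using sq by (auto simp: dsq_def)
  define w where "w = [(a, True), (b, True), (c, False), (d, False)]"
  have "map (side X s) [0..<4] = w"
    using s by (simp add: w_def upt_rec numeral_eq_Suc)
  then have w: "w \<in> relators X s"
    unfolding relators_def Let_def by (auto intro!: exI[of _ 0])
  have pp: "is_path X v p" "csrc X a = pend X v p"
    using p a by (auto simp: dpath_def out_def)
  \<comment> \<open>Insert the boundary word before the path \<open>d c\<close>. Deleting it as a
    relator leaves \<open>d c\<close>; cancelling first \<open>d\<close> and then \<open>c\<close>
    against their inverses leaves \<open>a b\<close>.\<close>
  let ?P = "p @ w @ [(d, True), (c, True)]"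
  have "hstep X v ?P (p @ [(d, True), (c, True)])"
    unfolding hstep_def
  proof (intro conjI disjI2 exI)
    show "w \<in> relators X s" "s \<in> cS X"
      by (rule w s(1))+
  qed (use pp S in \<open>auto simp: w_def\<close>)
  moreover have "hstep X v ?P (p @ [(a, True), (b, True), (c, False), (c, True)])"
    unfolding hstep_def
  proof (intro conjI disjI1 exI)
    show "?P = (p @ [(a, True), (b, True), (c, False)]) @ [(d, False), (d, \<not> False)] @ [(c, True)]"
      by (simp add: w_def)
  qed (use pp S in \<open>auto simp: w_def\<close>)
  moreover have "hstep X v (p @ [(a, True), (b, True), (c, False), (c, True)]) (p @ [(a, True), (b, True)])"
    unfolding hstep_def
  proof (intro conjI disjI1 exI)
    show "p @ [(a, True), (b, True), (c, False), (c, True)] =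
      (p @ [(a, True), (b, True)]) @ [(c, False), (c, \<not> False)] @ []"
      by simp
  qed (use pp S in auto)
  ultimately show ?thesis
    by (meson hstep_homot homot_sym homot_trans)
qed

text \<open>Extensions of different lengths have different heights, hence are different
  elements.\<close>

lemma filter_infinite:
  assumes p: "dpath p" and long: "\<And>n. \<exists>s. list_all snd s \<and> is_path X (pend X v p) s \<and> length s = n"
  shows "infinite (up D le (cl p))"
proof
  assume fin: "finite (up D le (cl p))"
  obtain s where s: "list_all snd (s n)" "is_path X (pend X v p) (s n)" "length (s n) = n" for n
    using long by metis
  have "cl (p @ s n) \<in> up D le (cl p)" for n
    using s by (auto simp: up_eq[OF p])
  then obtain i j where "i < j" "cl (p @ s i) = cl (p @ s j)"
    using pigeonhole_nat[OF fin, of "\<lambda>n. cl (p @ s n)"] by blast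
  then show False
    using homot_height[of "p @ s i" "p @ s j"] s by (simp add: cls_eq_iff height_positive)
qed

section \<open>Isomorphisms of labeled filters\<close>

lemma filter_iso_bottom:
  assumes "x \<in> D" "y \<in> D" and f: "bij_betw f (up D le x) (up D le y)"
    and ord: "\<And>a b. \<lbrakk>a \<in> up D le x; b \<in> up D le x\<rbrakk> \<Longrightarrow> le a b \<longleftrightarrow> le (f a) (f b)"
  shows "f x = y"
proof -
  have x: "x \<in> up D le x" and y: "y \<in> up D le y"
    using le_refl[OF assms(1)] le_refl[OF assms(2)] assms(1,2) by (simp_all add: up_def)
  \<comment> \<open>The preimage of \<open>y\<close> lies above \<open>x\<close>, so
    \<open>y\<close> lies above \<open>f x\<close>.\<close>
  obtain a where a: "a \<in> up D le x" "f a = y"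
    using f y unfolding bij_betw_def by (metis imageE)
  have fx: "f x \<in> up D le y"
    using f x by (auto simp: bij_betw_def)
  have "le (f x) y"
    using ord[OF x a(1)] a by (simp add: up_def)
  then show ?thesis
    using fx le_antisym[OF _ assms(2)] unfolding up_def by blast
qed

lemma up_subset: "x \<in> D \<Longrightarrow> a \<in> up D le x \<Longrightarrow> up D le a \<subseteq> up D le x"
  unfolding up_def using le_trans by blast

text \<open>Whatever lies above \<open>a\<close> lies in the filter of \<open>x\<close>, so covering
  between filter elements is decided inside the filter and is preserved by any order
  isomorphism.\<close>

lemma iso_covers:
  assumes D: "x \<in> D" "y \<in> D" and f: "bij_betw f (up D le x) (up D le y)"
    and ord: "\<And>a b. \<lbrakk>a \<in> up D le x; b \<in> up D le x\<rbrakk> \<Longrightarrow> le a b \<longleftrightarrow> le (f a) (f b)"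
    and ab: "a \<in> up D le x" "b \<in> up D le x"
  shows "covers D le a b \<longleftrightarrow> covers D le (f a) (f b)"
proof -
  have local: "covers D le a b \<longleftrightarrow> le a b \<and> a \<noteq> b \<and> \<not> (\<exists>z\<in>up D le w. le a z \<and> le z b \<and> z \<noteq> a \<and> z \<noteq> b)"
    if "w \<in> D" "a \<in> up D le w" "b \<in> up D le w" for a b w
    using that up_subset[of w a] unfolding covers_def up_def by blast
  have img: "f ` up D le x = up D le y" and inj: "inj_on f (up D le x)"
    using f by (auto simp: bij_betw_def)
  then have f_up: "f a \<in> up D le y" "f b \<in> up D le y"
    using ab by auto
  have eq: "f u = f w \<longleftrightarrow> u = w" if "u \<in> up D le x" "w \<in> up D le x" for u w
    using inj that by (auto dest: inj_onD)
  show ?thesis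
    unfolding local[OF D(1) ab] local[OF D(2) f_up] img[symmetric]
    by (simp add: ab ord eq cong: conj_cong)
qed

lemma iso_up:
  assumes D: "x \<in> D" "y \<in> D" and f: "bij_betw f (up D le x) (up D le y)"
    and ord: "\<And>a b. \<lbrakk>a \<in> up D le x; b \<in> up D le x\<rbrakk> \<Longrightarrow> le a b \<longleftrightarrow> le (f a) (f b)"
    and a: "a \<in> up D le x"
  shows "bij_betw f (up D le a) (up D le (f a))"
proof -
  have img: "f ` up D le x = up D le y" and inj: "inj_on f (up D le x)"
    using f by (auto simp: bij_betw_def)
  have sub: "up D le a \<subseteq> up D le x"
    using up_subset D(1) a by blast
  have fa: "f a \<in> up D le y"
    using img a by blast
  have sub': "up D le (f a) \<subseteq> up D le y"
    using up_subset D(2) fa by blast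
  have "f ` up D le a = up D le (f a)"
  proof
    show "f ` up D le a \<subseteq> up D le (f a)"
    proof
      fix z assume "z \<in> f ` up D le a"
      then obtain b where b: "b \<in> up D le a" "z = f b"
        by blast
      then have bx: "b \<in> up D le x"
        using sub by blast
      then have "f b \<in> D" "le (f a) (f b)"
        using ord[OF a bx] b img by (auto simp: up_def)
      then show "z \<in> up D le (f a)"
        using b by (simp add: up_def)
    qed
    show "up D le (f a) \<subseteq> f ` up D le a"
    proof
      fix z assume z: "z \<in> up D le (f a)"
      then obtain b where b: "b \<in> up D le x" "z = f b"
        using sub' img by blast
      then have "b \<in> up D le a"
        using ord[OF a b(1)] z by (simp add: up_def)
      then show "z \<in> f ` up D le a"
        using b by blast
    qed
  qed
  then show ?thesis
    using inj sub by (auto simp: bij_betw_def intro: inj_on_subset)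
qed

lemma filter_iso_sym:
  assumes D: "x \<in> D" "y \<in> D" and "filter_iso D le lab x y"
  shows "filter_iso D le lab y x"
proof -
  obtain f where f: "bij_betw f (up D le x) (up D le y)"
    and ord: "\<And>a b. \<lbrakk>a \<in> up D le x; b \<in> up D le x\<rbrakk> \<Longrightarrow> le a b \<longleftrightarrow> le (f a) (f b)"
    and lab: "\<And>a b. \<lbrakk>a \<in> up D le x; b \<in> up D le x; covers D le a b\<rbrakk> \<Longrightarrow> lab a b = lab (f a) (f b)"
    using assms(3) unfolding filter_iso_def by blast
  define g where "g = inv_into (up D le x) f"
  have g: "bij_betw g (up D le y) (up D le x)"
    unfolding g_def using f by (rule bij_betw_inv_into)
  have gD: "g a \<in> up D le x" "f (g a) = a" if "a \<in> up D le y" for a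
    using that f g by (auto simp: g_def bij_betw_def f_inv_into_f)
  have gord: "le a b \<longleftrightarrow> le (g a) (g b)" if "a \<in> up D le y" "b \<in> up D le y" for a b
    using ord[of "g a" "g b"] gD that by simp
  have "lab a b = lab (g a) (g b)" if "a \<in> up D le y" "b \<in> up D le y" "covers D le a b" for a b
    using iso_covers[OF D(2,1) g gord that(1,2)] lab[of "g a" "g b"] gD that by simp
  then show ?thesis
    unfolding filter_iso_def using g gord by blast
qed

lemma filter_iso_trans:
  assumes D: "x \<in> D" "y \<in> D" and "filter_iso D le lab x y" and "filter_iso D le lab y z"
  shows "filter_iso D le lab x z"
proof -
  obtain f where f: "bij_betw f (up D le x) (up D le y)"
    and ord: "\<And>a b. \<lbrakk>a \<in> up D le x; b \<in> up D le x\<rbrakk> \<Longrightarrow> le a b \<longleftrightarrow> le (f a) (f b)"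
    and lab: "\<And>a b. \<lbrakk>a \<in> up D le x; b \<in> up D le x; covers D le a b\<rbrakk> \<Longrightarrow> lab a b = lab (f a) (f b)"
    using assms(3) unfolding filter_iso_def by blast
  obtain g where g: "bij_betw g (up D le y) (up D le z)"
    and gord: "\<And>a b. \<lbrakk>a \<in> up D le y; b \<in> up D le y\<rbrakk> \<Longrightarrow> le a b \<longleftrightarrow> le (g a) (g b)"
    and glab: "\<And>a b. \<lbrakk>a \<in> up D le y; b \<in> up D le y; covers D le a b\<rbrakk> \<Longrightarrow> lab a b = lab (g a) (g b)"
    using assms(4) unfolding filter_iso_def by blast
  have fD: "f a \<in> up D le y" if "a \<in> up D le x" for a
    using f that by (auto simp: bij_betw_def)
  have "lab a b = lab (g (f a)) (g (f b))"
    if "a \<in> up D le x" "b \<in> up D le x" "covers D le a b" for a b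
    using iso_covers[OF D f ord that(1,2)] lab[OF that] glab[of "f a" "f b"] fD that by simp
  then show ?thesis
    unfolding filter_iso_def using bij_betw_trans[OF f g] ord gord fD
    by (intro exI[of _ "g \<circ> f"]) auto
qed

lemma covers_up: "covers D le x z \<Longrightarrow> z \<in> up D le x"
  by (auto simp: covers_def up_def)

text \<open>The isomorphism sends \<open>x\<close> to \<open>y\<close> and \<open>z\<close> to a
  cover of \<open>y\<close> with the label of \<open>z'\<close>. Distinct labels on edges out of
  \<open>y\<close> identify that cover with \<open>z'\<close>, and the isomorphism
  restricts.\<close>

lemma filter_iso_step:
  assumes nice: "nice_labeling D le lab" and D: "x \<in> D" "y \<in> D"
    and "filter_iso D le lab x y" and z: "covers D le x z" "covers D le y z'" "lab x z = lab y z'"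
  shows "filter_iso D le lab z z'"
proof -
  obtain f where f: "bij_betw f (up D le x) (up D le y)"
    and ord: "\<And>a b. \<lbrakk>a \<in> up D le x; b \<in> up D le x\<rbrakk> \<Longrightarrow> le a b \<longleftrightarrow> le (f a) (f b)"
    and lab: "\<And>a b. \<lbrakk>a \<in> up D le x; b \<in> up D le x; covers D le a b\<rbrakk> \<Longrightarrow> lab a b = lab (f a) (f b)"
    using assms(4) unfolding filter_iso_def by blast
  have fx: "f x = y"
    by (rule filter_iso_bottom[OF D f ord])
  have x: "x \<in> up D le x"
    using D(1) le_refl[OF D(1)] by (simp add: up_def)
  note zx = covers_up[OF z(1)]
  have "covers D le y (f z)"
    using iso_covers[OF D f ord x zx] z fx by simp
  moreover have "lab y (f z) = lab y z'"
    using lab[OF x zx z(1)] z(3) fx by simp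
  ultimately have fz: "f z = z'"
    using nice z(2) unfolding nice_labeling_def by metis
  have "bij_betw f (up D le z) (up D le z')"
    using iso_up[OF D f ord zx] fz by simp
  moreover have "up D le z \<subseteq> up D le x"
    using up_subset D(1) zx by blast
  ultimately show ?thesis
    unfolding filter_iso_def using ord lab by (intro exI[of _ f]) blast
qed

text \<open>Transfers the size of a finite filter above a cover; this is how the length of a tip
  will be compared at two midpoints.\<close>

lemma filter_iso_finite_cover:
  assumes D: "x \<in> D" "y \<in> D" and "filter_iso D le lab x y"
    and z: "covers D le x z" "finite (up D le z)"
  obtains z' where "covers D le y z'" "finite (up D le z')" "card (up D le z') = card (up D le z)"
proof -
  obtain f where f: "bij_betw f (up D le x) (up D le y)"
    and ord: "\<And>a b. \<lbrakk>a \<in> up D le x; b \<in> up D le x\<rbrakk> \<Longrightarrow> le a b \<longleftrightarrow> le (f a) (f b)"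
    using assms(3) unfolding filter_iso_def by blast
  have x: "x \<in> up D le x"
    using D(1) le_refl[OF D(1)] by (simp add: up_def)
  note zx = covers_up[OF z(1)]
  have "covers D le y (f z)"
    using iso_covers[OF D f ord x zx] z(1) filter_iso_bottom[OF D f ord] by simp
  moreover have "bij_betw f (up D le z) (up D le (f z))"
    by (rule iso_up[OF D f ord zx])
  ultimately show thesis
    using that z(2) bij_betw_finite bij_betw_same_card by metis
qed

lemma regular_recurrent:
  assumes reg: "regular_labeling D le lab" and Q: "\<And>i :: nat. Q i \<in> D"
  shows "\<exists>i j. i < j \<and> filter_iso D le lab (Q i) (Q j)"
proof -
  obtain F where F: "finite F" "F \<subseteq> D" "\<forall>x\<in>D. \<exists>y\<in>F. filter_iso D le lab x y"
    using reg by (auto simp: regular_labeling_def)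
  then have "\<forall>i. \<exists>y. y \<in> F \<and> filter_iso D le lab (Q i) y"
    using Q by blast
  from choice[OF this] obtain \<kappa> where "\<forall>i. \<kappa> i \<in> F \<and> filter_iso D le lab (Q i) (\<kappa> i)"
    by (elim exE)
  then have \<kappa>: "\<kappa> i \<in> F" "filter_iso D le lab (Q i) (\<kappa> i)" for i
    by simp_all
  obtain i j where ij: "i < j" "\<kappa> i = \<kappa> j"
    by (rule pigeonhole_nat[OF F(1) \<kappa>(1)])
  have "\<kappa> j \<in> D"
    using \<kappa>(1) F(2) by blast
  then have "filter_iso D le lab (Q i) (Q j)"
    using filter_iso_trans[OF Q _ \<kappa>(2)[of i]] filter_iso_sym[OF Q _ \<kappa>(2)[of j]] ij(2) by simp
  then show ?thesis
    using ij by blast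
qed

section \<open>Following edges in the domain\<close>

definition endv :: "('e \<times> bool) list set \<Rightarrow> 'v" where
  "endv x = pend X v (SOME p. p \<in> x)"

text \<open>An arbitrary representative is chosen; \<open>ext_cl\<close> shows independence of it
  for edges that start at the end vertex.\<close>

definition ext :: "('e \<times> bool) list set \<Rightarrow> 'e \<Rightarrow> ('e \<times> bool) list set" where
  "ext x e = cl ((SOME p. p \<in> x) @ [(e, True)])"

lemma some_cl: "homot X v p (SOME q. q \<in> cl p)"
  using someI[of "\<lambda>q. q \<in> cl p", OF cls_self] by (simp add: cls_def)

lemma endv_cl [simp]: "endv (cl p) = pend X v p"
  using homot_pend[OF some_cl] by (simp add: endv_def)

lemma ext_cl: "out p e \<Longrightarrow> ext (cl p) e = cl (p @ [(e, True)])"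
  using homot_append[OF some_cl, of p "[(e, True)]"]
  by (auto simp: ext_def out_def cls_eq_iff intro: homot_sym)

text \<open>Both routes around the square give one element. The square condition of
  \<open>nice_labeling\<close> concerns two distinct covers, which \<open>a \<noteq> d\<close>
  provides through \<open>cl_edge_inj\<close>.\<close>

lemma ext_square:
  assumes nice: "nice_labeling D le lab" and x: "x \<in> D" and sq: "dsq X a b c d"
    and a: "csrc X a = endv x" and ne: "a \<noteq> d"
  shows "ext (ext x a) b = ext (ext x d) c"
    and "lab x (ext x d) = lab (ext x a) (ext (ext x a) b)"
proof -
  obtain p where p: "dpath p" "x = cl p"
    using x by (auto simp: D_iff)
  note S = dsqD[OF wf sq]
  have o: "out p a" "out p d" "out (p @ [(a, True)]) b" "out (p @ [(d, True)]) c"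
    using S a p by (auto simp: out_def)
  note pa = out_dpath[OF p(1) o(1)] and pd = out_dpath[OF p(1) o(2)]
  have e: "ext x a = cl (p @ [(a, True)])" "ext x d = cl (p @ [(d, True)])"
    "ext (ext x a) b = cl (p @ [(a, True), (b, True)])"
    "ext (ext x d) c = cl (p @ [(d, True), (c, True)])"
    using ext_cl[OF o(1)] ext_cl[OF o(2)] ext_cl[OF o(3)] ext_cl[OF o(4)] p(2) by simp_all
  show eq: "ext (ext x a) b = ext (ext x d) c"
    using homot_square[OF p(1) sq o(1)] unfolding e(3,4) cls_eq_iff .
  have c: "covers D le x (ext x a)" "covers D le x (ext x d)"
    "covers D le (ext x a) (ext (ext x a) b)" "covers D le (ext x d) (ext (ext x a) b)"
    using covers_iff[OF p(1)] covers_iff[OF pa] covers_iff[OF pd] o p(2) e eq by auto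
  have "ext x a \<noteq> ext x d"
    using cl_edge_inj[OF p(1) o(1,2)] ne unfolding e(1,2) by blast
  moreover have "covers D le x' b' \<and> covers D le x' c' \<and> covers D le b' d' \<and> covers D le c' d' \<and> b' \<noteq> c'
      \<longrightarrow> lab x' b' = lab c' d' \<and> lab x' c' = lab b' d'" for x' b' c' d'
    using nice unfolding nice_labeling_def by (elim conjE allE)
  ultimately show "lab x (ext x d) = lab (ext x a) (ext (ext x a) b)"
    using c by blast
qed

end

section \<open>Tips and the recognition of colors\<close>

lemma WT_no_multi_edges:
  assumes "e \<in> cE (WT T r)" "e' \<in> cE (WT T r)" "wsrc e = wsrc e'" "wtgt e = wtgt e'"
  shows "e = e'"
  using assms by (cases e; cases e') (auto simp: WT_edges split: if_splits)

lemma WT_dsq_ne: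
  assumes "dsq (WT T r) a b c d"
  shows "a \<noteq> d"
proof -
  obtain t q where tq: "q < 4" "quad t q ! 0 = (a, True)" "quad t q ! 3 = (d, False)"
    using assms by (auto simp: dsq_def WT_cS WT_side)
  show ?thesis
    using tq unfolding less4 by (elim disjE) (auto simp: quad_def Let_def)
qed

locale labeled_domain =
  fixes T :: "('h,'v) tile set" and r :: "'h + 'v \<Rightarrow> nat"
    and lab :: "(('h,'v) wedge \<times> bool) list set \<Rightarrow> (('h,'v) wedge \<times> bool) list set \<Rightarrow> 'l"
  assumes inj: "inj_on r (colors T)" and pos: "\<forall>c\<in>colors T. 0 < r c"
    and labeling: "regular_nice_labeling (dom_elems (WT T r) Base) (dle (WT T r) Base) lab"
begin

sublocale directed_cx "WT T r" Base
  by unfold_locales (simp_all only: wf_WT WT_parallel WT_sel WT_no_multi_edges)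

lemma nice: "nice_labeling D le lab" and regular: "regular_labeling D le lab"
  using labeling by (auto simp: regular_nice_labeling_def)

text \<open>Once on a tip, a directed path can only continue along it, so the filter above the first
  tip edge is a chain whose size is the length of the tip.\<close>

lemma tip_filter:
  assumes p: "dpath p" "pend (WT T r) Base p = Mid c" and c: "c \<in> colors T"
  shows "covers D le (cl p) (cl (p @ [(TipE c 1, True)]))"
    and "finite (up D le (cl (p @ [(TipE c 1, True)])))"
    and "card (up D le (cl (p @ [(TipE c 1, True)]))) = r c"
proof -
  let ?p = "p @ [(TipE c 1, True)]"
  have rc: "1 \<le> r c"
    using pos c by (simp add: Suc_le_eq)
  have o: "out p (TipE c 1)"
    using p c rc by (simp add: out_def WT_edges)
  then show "covers D le (cl p) (cl ?p)"
    using covers_iff[OF p(1)] by blast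
  note dp = out_dpath[OF p(1) o]
  \<comment> \<open>The \<open>n\<close> tip edges that follow the vertex \<open>TipV c k\<close>;
    their indices start at \<open>k + 1\<close>, as edge \<open>k\<close> ends at that
    vertex.\<close>
  define tip where "tip k n = map (\<lambda>i. (TipE c i, True)) [Suc k..<Suc (k + n)]" for k n
  have tip_Suc: "tip k (Suc n) = (TipE c (Suc k), True) # tip (Suc k) n" for k n
    unfolding tip_def by (subst upt_rec) simp
  have tip_0: "tip k 0 = []" for k
    by (simp add: tip_def)
  have paths: "list_all snd s \<and> is_path (WT T r) (TipV c k) s \<longleftrightarrow>
      s = tip k (length s) \<and> k + length s \<le> r c" if "1 \<le> k" "k \<le> r c" for k s
    using that
  proof (induction s arbitrary: k)
    case Nil
    then show ?case by (simp add: tip_0)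
  next
    case (Cons a s)
    obtain e d where a: "a = (e, d)"
      by fastforce
    show ?case
    proof
      assume *: "list_all snd (a # s) \<and> is_path (WT T r) (TipV c k) (a # s)"
      then have d: "d" and e: "e \<in> cE (WT T r)" "wsrc e = TipV c k"
        by (auto simp: a)
      have e: "e = TipE c (Suc k) \<and> Suc k \<le> r c"
        using e Cons.prems by (cases e) (auto simp: WT_edges split: if_splits)
      then have "list_all snd s \<and> is_path (WT T r) (TipV c (Suc k)) s"
        using * a d by simp
      then have "s = tip (Suc k) (length s) \<and> Suc k + length s \<le> r c"
        using Cons.IH[of "Suc k"] e by simp
      then show "a # s = tip k (length (a # s)) \<and> k + length (a # s) \<le> r c"
        using a d e tip_Suc by simp
    next
      assume *: "a # s = tip k (length (a # s)) \<and> k + length (a # s) \<le> r c"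
      then have ad: "a = (TipE c (Suc k), True)" and s: "s = tip (Suc k) (length s)"
        using tip_Suc by auto
      have "Suc k \<le> r c"
        using * by simp
      have "list_all snd s \<and> is_path (WT T r) (TipV c (Suc k)) s"
        using Cons.IH[of "Suc k"] s * by simp
      then show "list_all snd (a # s) \<and> is_path (WT T r) (TipV c k) (a # s)"
        using \<open>Suc k \<le> r c\<close> Cons.prems c unfolding ad by (simp add: WT_edges)
    qed
  qed
  have len: "length (tip k n) = n" for k n
    by (simp add: tip_def)
  have *: "list_all snd s \<and> is_path (WT T r) (pend (WT T r) Base ?p) s \<longleftrightarrow>
      (\<exists>n<r c. s = tip 1 n)" for s
    using paths[of 1 s] rc len by (auto simp: Suc_le_eq)
  \<comment> \<open>One of the \<open>r c\<close> edges has been used to enter the tip, so the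
    remaining length \<open>n\<close> ranges from 0 to \<open>r c - 1\<close>, which gives exactly
    \<open>r c\<close> elements.\<close>
  have up: "up D le (cl ?p) = (\<lambda>n. cl (?p @ tip 1 n)) ` {..<r c}"
    unfolding up_eq[OF dp] * by blast
  then show "finite (up D le (cl ?p))"
    by simp
  have "inj_on (\<lambda>n. cl (?p @ tip 1 n)) {..<r c}"
  proof (rule inj_onI)
    fix m n assume "cl (?p @ tip 1 m) = cl (?p @ tip 1 n)"
    then have "height (tip 1 m) = height (tip 1 n)"
      using homot_height[of "?p @ tip 1 m" "?p @ tip 1 n"] by (simp add: cls_eq_iff)
    moreover have "list_all snd (tip 1 k)" for k
      by (simp add: tip_def list_all_iff)
    ultimately show "m = n"
      by (simp add: height_positive len)
  qed
  then show "card (up D le (cl ?p)) = r c"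
    unfolding up by (simp only: card_image card_lessThan)
qed

text \<open>After any edge outside the tips there is another such edge: the two halves of one color
  alternate, and a tile center leads on to a side midpoint and then to \<open>Base\<close>.\<close>

lemma long_paths:
  assumes "e \<in> cE (WT T r)" and "\<And>c k. e \<noteq> TipE c k"
  shows "\<exists>s. list_all snd s \<and> is_path (WT T r) (wtgt e) s \<and> length s = n"
  using assms
proof (induction n arbitrary: e)
  case 0
  then show ?case by simp
next
  case (Suc n)
  have "\<exists>e'. e' \<in> cE (WT T r) \<and> (\<forall>c k. e' \<noteq> TipE c k) \<and> wsrc e' = wtgt e"
  proof (cases e)
    case (HA c)
    then show ?thesis using Suc.prems by (intro exI[of _ "HB c"]) (simp add: WT_edges)
  next
    case (HB c)
    then show ?thesis using Suc.prems by (intro exI[of _ "HA c"]) (simp add: WT_edges)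
  next
    case (InL t)
    then show ?thesis using Suc.prems by (intro exI[of _ "OutR t"]) (simp add: WT_edges)
  next
    case (InB t)
    then show ?thesis using Suc.prems by (intro exI[of _ "OutR t"]) (simp add: WT_edges)
  next
    case (OutR t)
    then show ?thesis using Suc.prems colors_tile
      by (intro exI[of _ "HB (Inr (trgt t))"]) (simp add: WT_edges)
  next
    case (OutT t)
    then show ?thesis using Suc.prems colors_tile
      by (intro exI[of _ "HB (Inl (ttop t))"]) (simp add: WT_edges)
  next
    case (TipE c k)
    then show ?thesis using Suc.prems by simp
  qed
  then obtain e' where e': "e' \<in> cE (WT T r)" "\<And>c k. e' \<noteq> TipE c k" "wsrc e' = wtgt e"
    by blast
  obtain s where "list_all snd s" "is_path (WT T r) (wtgt e') s" "length s = n"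
    using Suc.IH[OF e'(1,2)] by blast
  then show ?case
    using e' by (intro exI[of _ "(e', True) # s"]) simp
qed

text \<open>Every edge out of a midpoint other than its tip edge starts arbitrarily long directed
  paths, so the filter above it is infinite.\<close>

lemma finite_filter_is_tip:
  assumes p: "dpath p" "pend (WT T r) Base p = Mid c"
    and z: "covers D le (cl p) z" "finite (up D le z)"
  shows "z = cl (p @ [(TipE c 1, True)])"
proof -
  obtain e where e: "out p e" "z = cl (p @ [(e, True)])"
    using z(1) covers_iff[OF p(1)] by blast
  have eE: "e \<in> cE (WT T r)" "wsrc e = Mid c"
    using e(1) p(2) by (auto simp: out_def)
  have "\<exists>c k. e = TipE c k"
  proof (rule ccontr)
    assume "\<nexists>c k. e = TipE c k"
    then have "infinite (up D le z)"
      unfolding e(2) using long_paths[OF eE(1)]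
      by (intro filter_infinite[OF out_dpath[OF p(1) e(1)]]) simp
    then show False
      using z(2) by simp
  qed
  then have "e = TipE c 1"
    using eE(2) by (auto split: if_splits)
  then show ?thesis
    using e(2) by simp
qed

text \<open>An isomorphism must match the only covers with finite filters, the two tips. Their sizes
  give \<open>r c = r c'\<close>, and \<open>r\<close> is injective.\<close>

lemma filter_iso_color:
  assumes x: "x \<in> D" "endv x = Mid c" "c \<in> colors T"
    and y: "y \<in> D" "endv y = Mid c'" "c' \<in> colors T"
    and iso: "filter_iso D le lab x y"
  shows "c = c'"
proof -
  obtain p where p: "dpath p" "x = cl p"
    using x(1) by (auto simp: D_iff)
  obtain q where q: "dpath q" "y = cl q"
    using y(1) by (auto simp: D_iff)
  have pq: "pend (WT T r) Base p = Mid c" "pend (WT T r) Base q = Mid c'"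
    using x(2) y(2) p q by auto
  note tip = tip_filter[OF p(1) pq(1) x(3), folded p(2)]
  obtain z' where z': "covers D le y z'" "finite (up D le z')" "card (up D le z') = r c"
    using filter_iso_finite_cover[OF x(1) y(1) iso tip(1,2)] tip(3) by metis
  have "z' = cl (q @ [(TipE c' 1, True)])"
    using finite_filter_is_tip[OF q(1) pq(2)] z' q(2) by simp
  then have "r c = r c'"
    using tip_filter(3)[OF q(1) pq(2) y(3)] z' by simp
  then show ?thesis
    using inj x(3) y(3) by (auto dest: inj_onD)
qed

text \<open>Here \<open>det\<close> rests on the distinct labels out of a vertex,
  \<open>square\<close> on the equal labels of opposite edges, and recurrence on regularity.\<close>

sublocale development T r D endv ext "\<lambda>x e. lab x (ext x e)" "filter_iso D le lab"
proof
  have "dpath []"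
    by (simp add: dpath_def)
  then show "\<exists>x\<in>D. endv x = Base"
    using cl_in_D by (intro bexI[of _ "cl []"]) auto
next
  fix x e assume *: "x \<in> D" "e \<in> cE (WT T r)" "wsrc e = endv x"
  then obtain p where p: "dpath p" "x = cl p"
    by (auto simp: D_iff)
  then have o: "out p e"
    using * by (simp add: out_def)
  then show "ext x e \<in> D \<and> endv (ext x e) = wtgt e"
    using cl_in_D[OF out_dpath[OF p(1) o]] by (simp add: p(2) ext_cl)
next
  fix x a b c d assume *: "x \<in> D" "dsq (WT T r) a b c d" "wsrc a = endv x"
  then show "ext (ext x a) b = ext (ext x d) c \<and> lab x (ext x d) = lab (ext x a) (ext (ext x a) b)"
    using ext_square[OF nice *(1,2)] WT_dsq_ne[OF *(2)] by simp
next
  fix x x' e e'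
  assume *: "x \<in> D" "x' \<in> D" "filter_iso D le lab x x'" "e \<in> cE (WT T r)" "e' \<in> cE (WT T r)"
    "wsrc e = endv x" "wsrc e' = endv x'" "lab x (ext x e) = lab x' (ext x' e')"
  have "covers D le y (ext y g)" if "y \<in> D" "g \<in> cE (WT T r)" "wsrc g = endv y" for y g
  proof -
    obtain p where p: "dpath p" "y = cl p"
      using \<open>y \<in> D\<close> by (auto simp: D_iff)
    then have o: "out p g"
      using that by (simp add: out_def)
    show ?thesis
      unfolding p(2) covers_iff[OF p(1)] using o ext_cl[OF o] by blast
  qed
  then show "filter_iso D le lab (ext x e) (ext x' e')"
    using filter_iso_step[OF nice *(1-3)] * by blast
next
  fix x x' c c'
  assume "x \<in> D" "x' \<in> D" "endv x = Mid c" "endv x' = Mid c'" "filter_iso D le lab x x'"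
    "c \<in> colors T" "c' \<in> colors T"
  then show "c = c'"
    using filter_iso_color by blast
next
  fix Q :: "nat \<Rightarrow> (('h,'v) wedge \<times> bool) list set"
  assume "\<And>i. Q i \<in> D"
  then show "\<exists>i j. i < j \<and> filter_iso D le lab (Q i) (Q j)"
    using regular_recurrent[OF regular] by blast
qed

end

theorem theorem7p2:
  fixes T :: "('h,'v) tile set" and r :: "'h + 'v \<Rightarrow> nat"
  assumes "finite T" and "four_way_det T" and "aperiodic T"
    and "inj_on r (colors T)" and "\<forall>c\<in>colors T. 0 < r c"
  shows "\<not> virtually_special (WT T r) \<and>
         \<not> (\<exists>lab :: (('h,'v) wedge \<times> bool) list set \<Rightarrow> (('h,'v) wedge \<times> bool) list set \<Rightarrow> nat.
              regular_nice_labeling (dom_elems (WT T r) Base) (dle (WT T r) Base) lab)"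
proof (intro conjI notI)
  assume "virtually_special (WT T r)"
  then obtain C :: "(nat, nat, nat) cx" and pv pe ps
    where "is_cover C (WT T r) pv pe ps" "finite (cV C)" "special C"
    by (auto simp: virtually_special_def finite_cover_def)
  then interpret special_cover T r C pv pe ps
    by unfold_locales
  show False
    using not_aperiodic assms by blast
next
  assume "\<exists>lab :: (('h,'v) wedge \<times> bool) list set \<Rightarrow> (('h,'v) wedge \<times> bool) list set \<Rightarrow> nat.
    regular_nice_labeling (dom_elems (WT T r) Base) (dle (WT T r) Base) lab"
  then obtain lab :: "(('h,'v) wedge \<times> bool) list set \<Rightarrow> (('h,'v) wedge \<times> bool) list set \<Rightarrow> nat"
    where "regular_nice_labeling (dom_elems (WT T r) Base) (dle (WT T r) Base) lab"
    by blast
  then interpret labeled_domain T r lab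
    using assms by unfold_locales auto
  show False
    using not_aperiodic assms by blast
qed

end
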